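(* Let $k \leq n$ be positive integers. The ideal $I_{n,k}^{(q)} \subseteq F[x_1,\dots,x_n]$ is stable under the action of the Hecke algebra $H_n(q)$ on $F[x_1,\dots,x_n]$. The quotient ring $R_{n,k}^{(q)} = F[x_1,\dots,x_n]/I_{n,k}^{(q)}$ is therefore a graded $H_n(q)$-module.
   Context: Let $q$ be a formal parameter and $F = \mathbb{Q}(q)$. The Hecke algebra $H_n(q)$ is the $F$-algebra generated by $T_1,\dots,T_{n-1}$ subject to $(T_i+1)(T_i-q)=0$ for $1\le i\le n-1$; $T_iT_j=T_jT_i$ for $|i-j|>1$; $T_iT_{i+1}T_i=T_{i+1}T_iT_{i+1}$ for $1\le i\le n-2$. Action on polynomials: for $1\le i\le n-1$, let $s_i$ act on $F[x_1,\dots,x_n]$ by swapping $x_i$ and $x_{i+1}$. Put $\partial_i.f := \frac{f - s_i.f}{x_i-x_{i+1}}$, $\pi_i.f := \partial_i.(x_i f)$, and $\overline{\pi}_i := \pi_i - 1$. The generator $T_i$ acts by $T_i.f := q\, (s_i.f) + (1-q)\, (\overline{\pi}_i.f)$; these operators satisfy the relations of $H_n(q)$. Hall-Littlewood polynomials: for $d \ge 1$ and $1 \le i \le n$, $P_d(x_1,\dots,x_i;q)\in F[x_1,\dots,x_i]$ is defined by the generating function $\sum_{d\ge 0} (1-q)P_d(x_1,\dots,x_i;q)\, t^d = \prod_{j=1}^i \frac{1-q x_j t}{1-x_j t}$. Let $e_d(x_1,\dots,x_n)$ be the elementary symmetric polynomial of degree $d$. For positive integers $k\le n$, define the homogeneous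 ideal $$I_{n,k}^{(q)} := \langle P_k(x_1;q), P_k(x_1,x_2;q),\dots,P_k(x_1,\dots,x_n;q),\ e_n(x_1,\dots,x_n), e_{n-1}(x_1,\dots,x_n),\dots,e_{n-k+1}(x_1,\dots,x_n)\rangle \subseteq F[x_1,\dots,x_n]$$ and $R_{n,k}^{(q)} := F[x_1,\dots,x_n]/I_{n,k}^{(q)}$, graded by polynomial degree. *)

theory Defs
  imports
    "HOL-Library.Poly_Mapping"
    "HOL-Computational_Algebra.Computational_Algebra"
    "HOL-Combinatorics.Transposition"
    "HOL-Algebra.QuotRing"
begin

section \<open>The field F = Q(q) and the polynomial rings F[x_1,...,x_n]\<close>

type_synonym qfield = "rat poly fract"

definition qpar :: qfield where
  "qpar = Fract [:0, 1:] 1"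

text \<open>
  Polynomials in countably many variables: a monomial is its exponent vector, and a polynomial is
  the finitely supported family of its coefficients. The ring with variables \<open>x\<^sub>1, \<dots>, x\<^sub>n\<close> is
  the subring of those polynomials in whose monomials only these variables occur.
\<close>

type_synonym mpol = "(nat \<Rightarrow>\<^sub>0 nat) \<Rightarrow>\<^sub>0 qfield"

definition const :: "qfield \<Rightarrow> mpol" where
  "const c = Poly_Mapping.single 0 c"

definition var :: "nat \<Rightarrow> mpol" where
  "var j = Poly_Mapping.single (Poly_Mapping.single j 1) 1"

definition pol_ring :: "nat \<Rightarrow> mpol ring" where
  "pol_ring n =
    \<lparr>carrier = {f. \<forall>m \<in> Poly_Mapping.keys f. Poly_Mapping.keys m \<subseteq> {1..n}},
     mult = (*), one = 1, zero = 0, add = (+)\<rparr>"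

definition homogeneous :: "nat \<Rightarrow> mpol \<Rightarrow> bool" where
  "homogeneous d f \<longleftrightarrow>
    (\<forall>m \<in> Poly_Mapping.keys f. (\<Sum>j \<in> Poly_Mapping.keys m. Poly_Mapping.lookup m j) = d)"


section \<open>The operators T_i on polynomials\<close>

text \<open>
  The coefficient of a monomial \<open>m\<close> in \<open>swap_vars i f\<close> is the coefficient in \<open>f\<close> of the monomial
  obtained from \<open>m\<close> by exchanging the exponents of \<open>x\<^sub>i\<close> and \<open>x\<^sub>i\<^sub>+\<^sub>1\<close>.
\<close>

definition swap_vars :: "nat \<Rightarrow> mpol \<Rightarrow> mpol" where
  "swap_vars i f =
    Poly_Mapping.map_key (Poly_Mapping.map_key (Transposition.transpose i (Suc i))) f"

text \<open>
  The polynomial quotient of \<open>f - s\<^sub>i.f\<close> by \<open>x\<^sub>i - x\<^sub>i\<^sub>+\<^sub>1\<close>; it exists and is unique, see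
  \<open>ddiff_mult\<close> below.
\<close>

definition ddiff :: "nat \<Rightarrow> mpol \<Rightarrow> mpol" where
  "ddiff i f = (THE g. (var i - var (Suc i)) * g = f - swap_vars i f)"

definition demazure :: "nat \<Rightarrow> mpol \<Rightarrow> mpol" where
  "demazure i f = ddiff i (var i * f)"

definition demazure_bar :: "nat \<Rightarrow> mpol \<Rightarrow> mpol" where
  "demazure_bar i f = demazure i f - f"

definition hecke_op :: "nat \<Rightarrow> mpol \<Rightarrow> mpol" where
  "hecke_op i f = const qpar * swap_vars i f + const (1 - qpar) * demazure_bar i f"


section \<open>The Hecke algebra by generators and relations\<close>

text \<open>
  The monoid algebra over \<open>F\<close> of the free monoid on the letters \<open>1, 2, \<dots>\<close> is the free algebra.
\<close>

datatype word = Word (letters: "nat list")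

instantiation word :: monoid_add
begin

definition zero_word :: word where
  "zero_word = Word []"

definition plus_word :: "word \<Rightarrow> word \<Rightarrow> word" where
  "plus_word v w = Word (letters v @ letters w)"

instance
  by standard (simp_all add: zero_word_def plus_word_def)

end

type_synonym free_alg = "word \<Rightarrow>\<^sub>0 qfield"

definition fscalar :: "qfield \<Rightarrow> free_alg" where
  "fscalar c = Poly_Mapping.single 0 c"

definition fgen :: "nat \<Rightarrow> free_alg" where
  "fgen i = Poly_Mapping.single (Word [i]) 1"

definition free_alg_ring :: "nat \<Rightarrow> free_alg ring" where
  "free_alg_ring n =
    \<lparr>carrier = {a. \<forall>w \<in> Poly_Mapping.keys a. set (letters w) \<subseteq> {1..<n}},
     mult = (*), one = 1, zero = 0, add = (+)\<rparr>"

definition hecke_relations :: "nat \<Rightarrow> free_alg set" where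
  "hecke_relations n =
    {(fgen i + 1) * (fgen i - fscalar qpar) | i. i \<in> {1..<n}} \<union>
    {fgen i * fgen j - fgen j * fgen i | i j.
       i \<in> {1..<n} \<and> j \<in> {1..<n} \<and> \<bar>int i - int j\<bar> > 1} \<union>
    {fgen i * fgen (i + 1) * fgen i - fgen (i + 1) * fgen i * fgen (i + 1) | i.
       1 \<le> i \<and> i + 2 \<le> n}"

text \<open>
  In \<^theory>\<open>HOL-Algebra.Ideal\<close> ideals, and hence generated ideals, are two-sided. An ideal of the
  free algebra is an \<open>F\<close>-subspace because the scalars \<open>fscalar c\<close> belong to the free algebra; so
  the quotient is the \<open>F\<close>-algebra with the given presentation.
\<close>

definition hecke_algebra :: "nat \<Rightarrow> free_alg set ring" where
  "hecke_algebra n =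
    free_alg_ring n Quot (Idl\<^bsub>free_alg_ring n\<^esub> (hecke_relations n))"


section \<open>Left modules and graded left modules\<close>

text \<open>
  The locale of modules in \<open>HOL-Algebra\<close> is restricted to commutative rings of scalars.
\<close>

locale left_module = R?: ring R + M?: abelian_group M
  for R :: "('r, 'c) ring_scheme" (structure)
    and M :: "('m, 'd) ring_scheme" (structure)
    and act :: "'r \<Rightarrow> 'm \<Rightarrow> 'm" +
  assumes act_closed:
      "\<lbrakk>a \<in> carrier R; x \<in> carrier M\<rbrakk> \<Longrightarrow> act a x \<in> carrier M"
    and act_l_distr:
      "\<lbrakk>a \<in> carrier R; b \<in> carrier R; x \<in> carrier M\<rbrakk> \<Longrightarrow>
        act (a \<oplus>\<^bsub>R\<^esub> b) x = act a x \<oplus>\<^bsub>M\<^esub> act b x"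
    and act_r_distr:
      "\<lbrakk>a \<in> carrier R; x \<in> carrier M; y \<in> carrier M\<rbrakk> \<Longrightarrow>
        act a (x \<oplus>\<^bsub>M\<^esub> y) = act a x \<oplus>\<^bsub>M\<^esub> act a y"
    and act_assoc:
      "\<lbrakk>a \<in> carrier R; b \<in> carrier R; x \<in> carrier M\<rbrakk> \<Longrightarrow>
        act (a \<otimes>\<^bsub>R\<^esub> b) x = act a (act b x)"
    and act_one:
      "x \<in> carrier M \<Longrightarrow> act \<one>\<^bsub>R\<^esub> x = x"

text \<open>
  Here the ring of scalars is concentrated in degree 0: every graded piece is a submodule, and the
  module is the internal direct sum of the pieces.
\<close>

locale graded_left_module = left_module R M act
  for R :: "('r, 'c) ring_scheme" (structure)
    and M :: "('m, 'd) ring_scheme" (structure)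
    and act :: "'r \<Rightarrow> 'm \<Rightarrow> 'm"
    and piece :: "nat \<Rightarrow> 'm set" +
  assumes piece_subgroup:
      "subgroup (piece d) (add_monoid M)"
    and piece_act_closed:
      "\<lbrakk>a \<in> carrier R; x \<in> piece d\<rbrakk> \<Longrightarrow> act a x \<in> piece d"
    and direct_sum:
      "x \<in> carrier M \<Longrightarrow>
        \<exists>!c :: nat \<Rightarrow> 'm.
          (\<forall>d. c d \<in> piece d) \<and> finite {d. c d \<noteq> \<zero>\<^bsub>M\<^esub>} \<and>
          x = finsum M c {d. c d \<noteq> \<zero>\<^bsub>M\<^esub>}"


section \<open>The action of the Hecke algebra on polynomials\<close>

definition free_act :: "free_alg \<Rightarrow> mpol \<Rightarrow> mpol" where
  "free_act a f =
    (\<Sum>w \<in> Poly_Mapping.keys a.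
      const (Poly_Mapping.lookup a w) * foldr hecke_op (letters w) f)"

text \<open>
  An element of the Hecke algebra is a coset \<open>h\<close> of elements of the free algebra, all of which act
  in the same way because the operators \<open>hecke_op i\<close> satisfy the Hecke relations; see
  \<open>hecke_act_coset\<close> and \<open>left_module_pol_ring\<close> below.
\<close>

definition hecke_act :: "free_alg set \<Rightarrow> mpol \<Rightarrow> mpol" where
  "hecke_act h f = the_elem ((\<lambda>a. free_act a f) ` h)"


section \<open>Hall-Littlewood and elementary symmetric polynomials\<close>

text \<open>
  The factor \<open>1 / (1 - x\<^sub>j t)\<close> is expanded as a geometric series in \<open>t\<close>; see
  \<open>hall_littlewood_gf\<close> below for the generating function in its usual form.
\<close>

definition hall_littlewood_series :: "nat \<Rightarrow> mpol fps" where
  "hall_littlewood_series i =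
    (\<Prod>j = 1..i. (1 - fps_const (const qpar * var j) * fps_X) * Abs_fps (\<lambda>m. var j ^ m))"

definition hall_littlewood :: "nat \<Rightarrow> nat \<Rightarrow> mpol" where
  "hall_littlewood d i = const (inverse (1 - qpar)) * fps_nth (hall_littlewood_series i) d"

definition elem_sym :: "nat \<Rightarrow> nat \<Rightarrow> mpol" where
  "elem_sym d n = (\<Sum>A | A \<subseteq> {1..n} \<and> card A = d. \<Prod>j \<in> A. var j)"


section \<open>The ideal and the quotient ring\<close>

definition hl_ideal :: "nat \<Rightarrow> nat \<Rightarrow> mpol set" where
  "hl_ideal n k =
    Idl\<^bsub>pol_ring n\<^esub>
      ({hall_littlewood k i | i. i \<in> {1..n}} \<union> {elem_sym d n | d. d \<in> {n - k + 1..n}})"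

definition hl_quotient :: "nat \<Rightarrow> nat \<Rightarrow> mpol set ring" where
  "hl_quotient n k = pol_ring n Quot hl_ideal n k"

definition hl_quotient_piece :: "nat \<Rightarrow> nat \<Rightarrow> nat \<Rightarrow> mpol set set" where
  "hl_quotient_piece n k d =
    {hl_ideal n k +>\<^bsub>pol_ring n\<^esub> f | f. f \<in> carrier (pol_ring n) \<and> homogeneous d f}"

text \<open>
  The induced action on cosets, in the style of \<^const>\<open>rcoset_mult\<close>: the coset \<open>I + f\<close> is sent to
  \<open>I + h.f\<close>.
\<close>

definition hl_quotient_act :: "nat \<Rightarrow> nat \<Rightarrow> free_alg set \<Rightarrow> mpol set \<Rightarrow> mpol set" where
  "hl_quotient_act n k h X = (\<Union>f \<in> X. hl_ideal n k +>\<^bsub>pol_ring n\<^esub> hecke_act h f)"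

section \<open>Polynomials: basic facts and existence of divided differences\<close>

abbreviation (input) "lkp \<equiv> Poly_Mapping.lookup"
abbreviation (input) "sgl \<equiv> Poly_Mapping.single"

lemma pm_sum_single: "(\<Sum>m \<in> Poly_Mapping.keys f. sgl m (lkp f m)) = f"
  for f :: "'a \<Rightarrow>\<^sub>0 'b::comm_monoid_add"
proof (rule poly_mapping_eqI)
  fix x
  have "lkp (\<Sum>m \<in> Poly_Mapping.keys f. sgl m (lkp f m)) x
     = (\<Sum>m \<in> Poly_Mapping.keys f. lkp (sgl m (lkp f m)) x)"
    by (induction rule: infinite_finite_induct) (auto simp: lookup_add)
  also have "\<dots> = (\<Sum>m \<in> Poly_Mapping.keys f. if m = x then lkp f m else 0)"
    by (intro sum.cong) (auto simp: lookup_single when_def)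
  also have "\<dots> = lkp f x" by (simp add: sum.delta in_keys_iff)
  finally show "lkp (\<Sum>m \<in> Poly_Mapping.keys f. sgl m (lkp f m)) x = lkp f x" .
qed

lemma pm_induct :
  fixes f :: "'a \<Rightarrow>\<^sub>0 'b::comm_monoid_add"
  assumes sub: "Poly_Mapping.keys f \<subseteq> A"
    and z: "P 0" and s: "\<And>m c. m \<in> A \<Longrightarrow> P (sgl m c)"
    and a: "\<And>f g. \<lbrakk>P f; P g\<rbrakk> \<Longrightarrow> P (f + g)"
  shows "P f"
proof -
  have "finite S \<Longrightarrow> S \<subseteq> A \<Longrightarrow> P (\<Sum>m \<in> S. sgl m (lkp f m))" for S
    by (induction S rule: finite_induct) (auto intro: z s a)
  from this[of "Poly_Mapping.keys f"] sub show ?thesis by (simp add: pm_sum_single)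
qed

lemma const_add: "const (a + b) = const a + const b"
  and const_mult: "const (a * b) = const a * const b"
  and const_0 [simp]: "const 0 = 0" and const_1 [simp]: "const 1 = 1"
  and const_diff: "const (a - b) = const a - const b"
  by (simp_all add: const_def single_add mult_single single_diff)

lemma mem_pol: "f \<in> carrier (pol_ring n) \<longleftrightarrow> Poly_Mapping.keys f \<subseteq> {m. Poly_Mapping.keys m \<subseteq> {1..n}}"
  by (auto simp: pol_ring_def)

lemma pol_simps [simp]:
  "mult (pol_ring n) = (*)" "one (pol_ring n) = 1" "zero (pol_ring n) = 0" "add (pol_ring n) = (+)"
  by (simp_all add: pol_ring_def)

lemma keys_plus_nat: "Poly_Mapping.keys (a + b) \<subseteq> Poly_Mapping.keys a \<union> Poly_Mapping.keys b"
  by (rule Poly_Mapping.keys_add)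

lemma pol_0 [simp]: "0 \<in> carrier (pol_ring n)" and pol_1 [simp]: "1 \<in> carrier (pol_ring n)"
  and pol_const [simp]: "const c \<in> carrier (pol_ring n)"
  by (auto simp: mem_pol const_def)

lemma pol_var: "j \<in> {1..n} \<Longrightarrow> var j \<in> carrier (pol_ring n)"
  by (auto simp: mem_pol var_def)

lemma pol_add: "f \<in> carrier (pol_ring n) \<Longrightarrow> g \<in> carrier (pol_ring n) \<Longrightarrow> f + g \<in> carrier (pol_ring n)"
  using Poly_Mapping.keys_add[of f g] unfolding mem_pol by blast

lemma pol_mult: "f \<in> carrier (pol_ring n) \<Longrightarrow> g \<in> carrier (pol_ring n) \<Longrightarrow> f * g \<in> carrier (pol_ring n)"
  unfolding mem_pol
proof
  fix m assume "Poly_Mapping.keys f \<subseteq> {m. Poly_Mapping.keys m \<subseteq> {1..n}}" "Poly_Mapping.keys g \<subseteq> {m. Poly_Mapping.keys m \<subseteq> {1..n}}"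
    "m \<in> Poly_Mapping.keys (f * g)"
  then obtain a b where "m = a + b" "Poly_Mapping.keys a \<subseteq> {1..n}" "Poly_Mapping.keys b \<subseteq> {1..n}"
    using keys_mult[of f g] by blast
  thus "m \<in> {m. Poly_Mapping.keys m \<subseteq> {1..n}}" using keys_plus_nat[of a b] by auto
qed

lemma pol_uminus: "f \<in> carrier (pol_ring n) \<Longrightarrow> - f \<in> carrier (pol_ring n)"
  by (simp add: mem_pol)

lemma pol_diff: "f \<in> carrier (pol_ring n) \<Longrightarrow> g \<in> carrier (pol_ring n) \<Longrightarrow> f - g \<in> carrier (pol_ring n)"
  using pol_add[OF _ pol_uminus, of f n g] by simp

lemma pol_cring: "cring (pol_ring n)"
proof (rule cringI)
  show "abelian_group (pol_ring n)"
  proof (rule abelian_groupI)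
    show "\<exists>y\<in>carrier (pol_ring n). y \<oplus>\<^bsub>pol_ring n\<^esub> x = \<zero>\<^bsub>pol_ring n\<^esub>" if "x \<in> carrier (pol_ring n)" for x
      using pol_uminus[OF that] by (intro bexI[of _ "- x"]) auto
  qed (simp_all add: pol_add add.assoc add.commute)
  show "comm_monoid (pol_ring n)"
    by (rule comm_monoidI) (simp_all add: pol_mult ac_simps)
qed (simp_all add: distrib_right)

abbreviation (input) "tr i \<equiv> Transposition.transpose i (Suc i)"
abbreviation (input) "trm i \<equiv> (Poly_Mapping.map_key (tr i) :: (nat \<Rightarrow>\<^sub>0 nat) \<Rightarrow> _)"

lemma inj_tr [simp]: "inj (tr i)" by simp
lemma trm_trm [simp]: "trm i (trm i m) = m"
  by (simp add: map_key_compose map_key_id o_def)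
lemma inj_trm [simp]: "inj (trm i)"
  by (metis injI trm_trm)
lemma trm_add [simp]: "trm i (a + b) = trm i a + trm i b"
  by (simp add: map_key_plus)

lemma swap_single [simp]: "swap_vars i (sgl m c) = sgl (trm i m) c"
  using map_key_single[OF inj_trm, of i "trm i m" c] by (simp add: swap_vars_def)
lemma swap_add [simp]: "swap_vars i (f + g) = swap_vars i f + swap_vars i g"
  by (simp add: swap_vars_def map_key_plus)
lemma swap_0 [simp]: "swap_vars i 0 = 0"
  by (simp add: swap_vars_def)
lemma swap_swap [simp]: "swap_vars i (swap_vars i f) = f"
  by (induction f rule: pm_induct[where A = UNIV]) auto
lemma swap_mult [simp]: "swap_vars i (f * g) = swap_vars i f * swap_vars i g"
proof (induction f rule: pm_induct[where A = UNIV])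
  case (3 m c)
  show ?case
    by (induction g rule: pm_induct[where A = UNIV]) (auto simp: mult_single distrib_left)
qed (auto simp: distrib_right)
lemma swap_diff [simp]: "swap_vars i (f - g) = swap_vars i f - swap_vars i g"
  using swap_add[of i "f - g" g] by (simp del: swap_add)
lemma swap_const [simp]: "swap_vars i (const c) = const c"
  by (simp add: const_def)
lemma swap_var [simp]: "swap_vars i (var j) = var (tr i j)"
  using map_key_single[OF inj_tr, of i "tr i j" "1::nat"] by (simp add: var_def)

lemma var_neq: "var i - var (Suc i) \<noteq> 0"
proof
  assume "var i - var (Suc i) = 0"
  hence "lkp (var i) (sgl i 1) = lkp (var (Suc i)) (sgl i 1)" by simp
  thus False by (auto simp: var_def lookup_single when_def dest!: arg_cong[where f = "\<lambda>m. lkp m i"] split: if_splits)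
qed

lemma ddiff_ex_mono:
  assumes i: "i \<in> {1..<n}" and "Poly_Mapping.keys m \<subseteq> {1..n}"
  shows "\<exists>g \<in> carrier (pol_ring n). (var i - var (Suc i)) * g = sgl m c - swap_vars i (sgl m c)"
  using assms(2)
proof (induction "\<Sum>j\<in>Poly_Mapping.keys m. lkp m j" arbitrary: m)
  case 0
  hence "m = 0" by (auto simp: poly_mapping_eqI in_keys_iff)
  thus ?case by (intro bexI[of _ 0]) (auto)
next
  case (Suc s m)
  then obtain j where j: "j \<in> Poly_Mapping.keys m" by fastforce
  define m' where "m' = m - sgl j 1"
  have m: "m = sgl j 1 + m'"
    using j by (auto intro!: poly_mapping_eqI simp: m'_def lookup_add lookup_minus lookup_single when_def in_keys_iff)
  have k: "Poly_Mapping.keys m' \<subseteq> Poly_Mapping.keys m"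
    by (auto simp: m in_keys_iff lookup_add)
  have "(\<Sum>j\<in>Poly_Mapping.keys m. lkp m j) = (\<Sum>l\<in>Poly_Mapping.keys m. (if l = j then 1 else 0) + lkp m' l)"
    by (intro sum.cong) (auto simp: m lookup_add lookup_single when_def)
  also have "\<dots> = Suc (\<Sum>l\<in>Poly_Mapping.keys m. lkp m' l)"
    using j by (simp add: sum.distrib)
  also have "(\<Sum>l\<in>Poly_Mapping.keys m. lkp m' l) = (\<Sum>l\<in>Poly_Mapping.keys m'. lkp m' l)"
    using k by (intro sum.mono_neutral_right) (auto simp: in_keys_iff)
  finally have "s = (\<Sum>l\<in>Poly_Mapping.keys m'. lkp m' l)" using Suc.hyps(2) by simp
  from Suc.hyps(1)[OF this] k Suc.prems obtain g where g: "g \<in> carrier (pol_ring n)"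
    "(var i - var (Suc i)) * g = sgl m' c - swap_vars i (sgl m' c)" by blast
  have s: "sgl m c = var j * sgl m' c" by (simp add: m var_def mult_single)
  obtain e where e: "e \<in> carrier (pol_ring n)" "var j - swap_vars i (var j) = (var i - var (Suc i)) * e"
  proof -
   consider "j = i" | "j \<noteq> i" "j = Suc i" | "j \<noteq> i" "j \<noteq> Suc i" by blast
   thus ?thesis
   proof cases
    assume "j = i" with that[of 1] show ?thesis by (simp)
  next
    assume "j \<noteq> i" "j = Suc i" with that[of "-1"] show ?thesis by (simp add: pol_uminus)
  next
    assume "j \<noteq> i" "j \<noteq> Suc i" with that[of "0"] show ?thesis by (simp add: transpose_def)
   qed
  qed
  let ?m = "sgl m' c"
  have "sgl m c - swap_vars i (sgl m c) = var j * ?m - swap_vars i (var j) * swap_vars i ?m"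
    by (simp only: s swap_mult)
  also have "\<dots> = (var j - swap_vars i (var j)) * ?m + swap_vars i (var j) * (?m - swap_vars i ?m)"
    by (simp only: ring_distribs) simp
  also have "\<dots> = (var i - var (Suc i)) * (e * ?m + swap_vars i (var j) * g)"
    by (simp only: e(2) g(2)[symmetric] ring_distribs ac_simps)
  finally have E: "(var i - var (Suc i)) * (e * ?m + swap_vars i (var j) * g) = sgl m c - swap_vars i (sgl m c)" ..
  have jn: "tr i j \<in> {1..n}" using j Suc.prems i by (auto simp: transpose_def)
  have mm: "?m \<in> carrier (pol_ring n)" using k Suc.prems by (auto simp: mem_pol)
  have "e * ?m + swap_vars i (var j) * g \<in> carrier (pol_ring n)"
    by (auto intro!: pol_add pol_mult e g mm pol_var jn simp del: atLeastAtMost_iff)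
  with E show ?case by blast
qed

lemma ddiff_ex:
  assumes i: "i \<in> {1..<n}" and "f \<in> carrier (pol_ring n)"
  shows "\<exists>g \<in> carrier (pol_ring n). (var i - var (Suc i)) * g = f - swap_vars i f"
proof -
  have "Poly_Mapping.keys f \<subseteq> {m. Poly_Mapping.keys m \<subseteq> {1..n}}" using assms by (simp add: mem_pol)
  thus ?thesis
  proof (rule pm_induct[where P = "\<lambda>f. \<exists>g \<in> carrier (pol_ring n). (var i - var (Suc i)) * g = f - swap_vars i f"])
    show "\<exists>g \<in> carrier (pol_ring n). (var i - var (Suc i)) * g = 0 - swap_vars i 0" 
      by (intro bexI[of _ 0]) auto
  next
    fix m :: "nat \<Rightarrow>\<^sub>0 nat" and c assume "m \<in> {m. Poly_Mapping.keys m \<subseteq> {1..n}}"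
    thus "\<exists>g \<in> carrier (pol_ring n). (var i - var (Suc i)) * g = sgl m c - swap_vars i (sgl m c)" 
      using ddiff_ex_mono[OF i] by blast
  next
    fix f g
    assume "\<exists>h \<in> carrier (pol_ring n). (var i - var (Suc i)) * h = f - swap_vars i f"
      "\<exists>h \<in> carrier (pol_ring n). (var i - var (Suc i)) * h = g - swap_vars i g"
    then obtain a b where "a \<in> carrier (pol_ring n)" "b \<in> carrier (pol_ring n)"
      "(var i - var (Suc i)) * a = f - swap_vars i f" "(var i - var (Suc i)) * b = g - swap_vars i g" by blast
    thus "\<exists>h \<in> carrier (pol_ring n). (var i - var (Suc i)) * h = f + g - swap_vars i (f + g)" 
      by (intro bexI[of _ "a + b"]) (auto intro: pol_add simp: distrib_left)
  qed
qed

lemma ddiff: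
  assumes i: "i \<in> {1..<n}" and "f \<in> carrier (pol_ring n)"
  shows ddiff_mult: "(var i - var (Suc i)) * ddiff i f = f - swap_vars i f"
    and ddiff_closed: "ddiff i f \<in> carrier (pol_ring n)"
proof -
  obtain g where g: "g \<in> carrier (pol_ring n)" "(var i - var (Suc i)) * g = f - swap_vars i f"
    using ddiff_ex[OF assms] by blast
  have "ddiff i f = g" unfolding ddiff_def
    using g(2) var_neq[of i] by (intro the_equality) (auto simp flip: g(2))
  with g show "(var i - var (Suc i)) * ddiff i f = f - swap_vars i f" "ddiff i f \<in> carrier (pol_ring n)" by auto
qed

lemma swap_closed:
  assumes i: "i \<in> {1..<n}" and "f \<in> carrier (pol_ring n)"
  shows "swap_vars i f \<in> carrier (pol_ring n)"
proof -
  have "f - (var i - var (Suc i)) * ddiff i f \<in> carrier (pol_ring n)"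
    using i by (intro pol_diff pol_mult assms ddiff_closed pol_var) auto
  thus ?thesis by (simp add: ddiff_mult[OF assms])
qed

lemma hecke_op_closed:
  assumes i: "i \<in> {1..<n}" and "f \<in> carrier (pol_ring n)"
  shows "hecke_op i f \<in> carrier (pol_ring n)"
  unfolding hecke_op_def demazure_bar_def demazure_def using assms
  by (intro pol_add pol_mult pol_const pol_diff ddiff_closed swap_closed pol_var) auto

lemma hecke_op_mult:
  assumes i: "i \<in> {1..<n}" and "f \<in> carrier (pol_ring n)"
  shows "(var i - var (Suc i)) * hecke_op i f
    = (const qpar * var i - var (Suc i)) * swap_vars i f + (1 - const qpar) * var (Suc i) * f"
proof -
  have d: "(var i - var (Suc i)) * ddiff i (var i * f) = var i * f - var (Suc i) * swap_vars i f"
    using ddiff_mult[OF i, of "var i * f"] assms by (simp add: pol_mult pol_var)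
  have "(var i - var (Suc i)) * hecke_op i f = (var i - var (Suc i)) * const qpar * swap_vars i f
     + (1 - const qpar) * ((var i - var (Suc i)) * ddiff i (var i * f) - (var i - var (Suc i)) * f)"
    by (simp add: hecke_op_def demazure_bar_def demazure_def const_diff algebra_simps)
  thus ?thesis unfolding d by (simp add: algebra_simps)
qed

lemma hecke_op_eqI:
  assumes i: "i \<in> {1..<n}" "f \<in> carrier (pol_ring n)"
   "(var i - var (Suc i)) * g
    = (const qpar * var i - var (Suc i)) * swap_vars i f + (1 - const qpar) * var (Suc i) * f"
  shows "hecke_op i f = g"
  using hecke_op_mult[OF i(1,2)] i(3) var_neq[of i] by (metis mult_left_cancel)

lemma hecke_op_add:
  assumes "i \<in> {1..<n}" "f \<in> carrier (pol_ring n)" "g \<in> carrier (pol_ring n)"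
  shows "hecke_op i (f + g) = hecke_op i f + hecke_op i g"
  by (rule hecke_op_eqI[OF assms(1)]) (use assms in \<open>auto simp: pol_add distrib_left hecke_op_mult[OF assms(1)]\<close>)

lemma hecke_op_const:
  assumes "i \<in> {1..<n}" "f \<in> carrier (pol_ring n)"
  shows "hecke_op i (const c * f) = const c * hecke_op i f"
proof (rule hecke_op_eqI[OF assms(1)])
  have "(var i - var (Suc i)) * (const c * hecke_op i f) = const c * ((var i - var (Suc i)) * hecke_op i f)"
    by (simp only: ac_simps)
  thus "(var i - var (Suc i)) * (const c * hecke_op i f) = (const qpar * var i - var (Suc i)) * swap_vars i (const c * f) +
    (1 - const qpar) * var (Suc i) * (const c * f)"
    unfolding hecke_op_mult[OF assms] by (simp add: algebra_simps)
qed (use assms in \<open>auto intro: pol_mult\<close>)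

lemma hecke_op_mono:
  "i \<in> {1..<n} \<Longrightarrow> f \<in> carrier (pol_ring n) \<Longrightarrow> 
   swap_vars j (var i - var (Suc i)) * swap_vars j (hecke_op i f)
    = (const qpar * swap_vars j (var i) - swap_vars j (var (Suc i))) * swap_vars j (swap_vars i f) + (1 - const qpar) * swap_vars j (var (Suc i)) * swap_vars j f"
  using arg_cong[OF hecke_op_mult[of i n f], of "swap_vars j"] by (auto simp: swap_const[of _ 1, simplified])


section \<open>The Hecke relations for the operators T_i\<close>

lemma quad_aux:
  fixes x y q h sh f sf :: "'a::comm_ring_1"
  assumes a: "(x - y) * h = (q * x - y) * sf + (1 - q) * y * f"
  and b: "(y - x) * sh = (q * y - x) * f + (1 - q) * x * sf"
  shows "(x - y) * ((x - y) * ((q - 1) * h + q * f)) = (x - y) * ((q * x - y) * sh + (1 - q) * y * h)"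
proof -
  have "(x - y) * ((x - y) * ((q - 1) * h + q * f)) = (x - y) * ((q - 1) * ((x - y) * h) + q * (x - y) * f)"
    by (simp add: algebra_simps)
  note p = this
  have r: "(x - y) * ((q * x - y) * sh + (1 - q) * y * h) = (1 - q) * y * ((x - y) * h) - (q * x - y) * ((y - x) * sh)"
    by (simp add: algebra_simps)
  show ?thesis unfolding p r unfolding a b by (simp add: algebra_simps)
qed

lemma hecke_quad:
  assumes i: "i \<in> {1..<n}" and f: "f \<in> carrier (pol_ring n)"
  shows "hecke_op i (hecke_op i f) = (const qpar - 1) * hecke_op i f + const qpar * f"
proof (rule hecke_op_eqI[OF i hecke_op_closed[OF i f]])
  let ?D = "var i - var (Suc i)" let ?h = "hecke_op i f" let ?q = "const qpar"
  have a: "?D * ?h = (?q * var i - var (Suc i)) * swap_vars i f + (1 - ?q) * var (Suc i) * f"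
    by (rule hecke_op_mult[OF i f])
  have b: "(var (Suc i) - var i) * swap_vars i ?h = (?q * var (Suc i) - var i) * f + (1 - ?q) * var i * swap_vars i f"
    using hecke_op_mono[OF i f, of i] by simp
  from quad_aux[OF a b]
  show "?D * ((?q - 1) * ?h + ?q * f) = ((?q * var i - var (Suc i)) * swap_vars i ?h + (1 - ?q) * var (Suc i) * ?h)"
    using var_neq[of i] by simp
qed

lemma commute_aux:
  fixes x y u v q f sf tf stf h g sg th t :: "'a::comm_ring_1"
  assumes "(u - v) * t = (q * u - v) * th + (1 - q) * v * h"
   and "(x - y) * h = (q * x - y) * sf + (1 - q) * y * f"
   and "(x - y) * th = (q * x - y) * stf + (1 - q) * y * tf"
  shows "(x - y) * (u - v) * t = (q * u - v) * (q * x - y) * stf + (q * u - v) * (1 - q) * y * tf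
    + (1 - q) * v * (q * x - y) * sf + (1 - q) * v * (1 - q) * y * f"
proof -
  have "(x - y) * (u - v) * t = (q * u - v) * ((x - y) * th) + (1 - q) * v * ((x - y) * h)"
    using assms(1) by (simp add: mult.assoc) (simp add: algebra_simps)
  thus ?thesis unfolding assms(2,3) by (simp add: algebra_simps)
qed

lemma swap_commute:
  assumes "j \<noteq> i" "j \<noteq> Suc i" "i \<noteq> Suc j"
  shows "swap_vars i (swap_vars j f) = swap_vars j (swap_vars i f)"
proof (induction f rule: pm_induct[where A = UNIV])
  case (3 m c)
  have "tr i \<circ> tr j = tr j \<circ> tr i" using assms by (auto simp: transpose_def fun_eq_iff)
  thus ?case by (simp add: map_key_compose)
qed auto

lemma hecke_commute:
  assumes i: "i \<in> {1..<n}" and j: "j \<in> {1..<n}" and f: "f \<in> carrier (pol_ring n)"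
    and ij: "j \<noteq> i" "j \<noteq> Suc i" "i \<noteq> Suc j"
  shows "hecke_op i (hecke_op j f) = hecke_op j (hecke_op i f)"
proof -
  have [simp]: "tr i j = j" "tr i (Suc j) = Suc j" "tr j i = i" "tr j (Suc i) = Suc i" using ij
    by (auto simp: transpose_def)
  note A = commute_aux[OF hecke_op_mult[OF i hecke_op_closed[OF j f]] hecke_op_mult[OF j f]
     hecke_op_mono[OF j f, of i, simplified]]
  note B = commute_aux[OF hecke_op_mult[OF j hecke_op_closed[OF i f]] hecke_op_mult[OF i f]
     hecke_op_mono[OF i f, of j, simplified]]
  have "(var i - var (Suc i)) * (var j - var (Suc j)) * hecke_op i (hecke_op j f) = 
    (var i - var (Suc i)) * (var j - var (Suc j)) * hecke_op j (hecke_op i f)"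
    unfolding B using A by (simp only: swap_commute[OF ij]) (simp add: algebra_simps)
  thus ?thesis using var_neq by (simp)
qed

lemma braid_aux1:
  fixes x y z q f f1 f2 f12 f21 f121 t g g1 h h1 h2 h12 :: "'a::comm_ring_1"
  assumes "(x - y) * t = (q * x - y) * g1 + (1 - q) * y * g"
   and "(y - z) * g = (q * y - z) * h2 + (1 - q) * z * h"
   and "(x - z) * g1 = (q * x - z) * h12 + (1 - q) * z * h1"
   and "(x - y) * h = (q * x - y) * f1 + (1 - q) * y * f"
   and "(y - x) * h1 = (q * y - x) * f + (1 - q) * x * f1"
   and "(x - z) * h2 = (q * x - z) * f21 + (1 - q) * z * f2"
   and "(y - z) * h12 = (q * y - z) * f121 + (1 - q) * z * f12"
  shows "(x - y) * (x - y) * (y - z) * (x - z) * t = 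
    (q * x - y) * ((q * x - z) * (x - y) * ((q * y - z) * f121 + (1 - q) * z * f12) 
       - (1 - q) * z * (y - z) * ((q * y - x) * f + (1 - q) * x * f1))
   + (1 - q) * y * ((q * y - z) * (x - y) * ((q * x - z) * f21 + (1 - q) * z * f2) 
       + (1 - q) * z * (x - z) * ((q * x - y) * f1 + (1 - q) * y * f))"
proof -
  have "(x - y) * (x - y) * (y - z) * (x - z) * t = (x - y) * (y - z) * (x - z) * ((x - y) * t)"
    by (simp only: ac_simps)
  also have "\<dots> = (x - y) * ((q * x - y) * (y - z) * ((x - z) * g1) + (1 - q) * y * (x - z) * ((y - z) * g))"
    unfolding assms(1) by (simp only: distrib_left ac_simps)
  also have "\<dots> = (q * x - y) * ((q * x - z) * (x - y) * ((y - z) * h12) 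
       - (1 - q) * z * (y - z) * ((y - x) * h1))
   + (1 - q) * y * ((q * y - z) * (x - y) * ((x - z) * h2) 
       + (1 - q) * z * (x - z) * ((x - y) * h))"
    unfolding assms(2,3) by (simp add: algebra_simps)
  finally show ?thesis unfolding assms(4-7) .
qed

lemma braid_aux2:
  fixes x y z q f f1 f2 f12 f21 f121 t g g2 h h1 h2 h21 :: "'a::comm_ring_1"
  assumes "(y - z) * t = (q * y - z) * g2 + (1 - q) * z * g"
   and "(x - y) * g = (q * x - y) * h1 + (1 - q) * y * h"
   and "(x - z) * g2 = (q * x - z) * h21 + (1 - q) * z * h2"
   and "(y - z) * h = (q * y - z) * f2 + (1 - q) * z * f"
   and "(z - y) * h2 = (q * z - y) * f + (1 - q) * y * f2"
   and "(x - z) * h1 = (q * x - z) * f12 + (1 - q) * z * f1"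
   and "(x - y) * h21 = (q * x - y) * f121 + (1 - q) * y * f21"
  shows "(y - z) * (y - z) * (x - y) * (x - z) * t = 
    (q * y - z) * ((q * x - z) * (y - z) * ((q * x - y) * f121 + (1 - q) * y * f21) 
       - (1 - q) * z * (x - y) * ((q * z - y) * f + (1 - q) * y * f2))
   + (1 - q) * z * ((q * x - y) * (y - z) * ((q * x - z) * f12 + (1 - q) * z * f1) 
       + (1 - q) * y * (x - z) * ((q * y - z) * f2 + (1 - q) * z * f))"
proof -
  have "(y - z) * (y - z) * (x - y) * (x - z) * t = (y - z) * (x - y) * (x - z) * ((y - z) * t)"
    by (simp only: ac_simps)
  also have "\<dots> = (y - z) * ((q * y - z) * (x - y) * ((x - z) * g2) + (1 - q) * z * (x - z) * ((x - y) * g))"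
    unfolding assms(1) by (simp only: distrib_left ac_simps)
  also have "\<dots> = (q * y - z) * ((q * x - z) * (y - z) * ((x - y) * h21) 
       - (1 - q) * z * (x - y) * ((z - y) * h2))
   + (1 - q) * z * ((q * x - y) * (y - z) * ((x - z) * h1) 
       + (1 - q) * y * (x - z) * ((y - z) * h))"
    unfolding assms(2,3) by (simp add: algebra_simps)
  finally show ?thesis unfolding assms(4-7) .
qed

lemma braid_aux3:
  fixes x y z q f f1 f2 f12 f21 f121 :: "'a::comm_ring_1"
  shows "(y - z) * (
    (q * x - y) * ((q * x - z) * (x - y) * ((q * y - z) * f121 + (1 - q) * z * f12) 
       - (1 - q) * z * (y - z) * ((q * y - x) * f + (1 - q) * x * f1))
   + (1 - q) * y * ((q * y - z) * (x - y) * ((q * x - z) * f21 + (1 - q) * z * f2) 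
       + (1 - q) * z * (x - z) * ((q * x - y) * f1 + (1 - q) * y * f)))
  = (x - y) * (
    (q * y - z) * ((q * x - z) * (y - z) * ((q * x - y) * f121 + (1 - q) * y * f21) 
       - (1 - q) * z * (x - y) * ((q * z - y) * f + (1 - q) * y * f2))
   + (1 - q) * z * ((q * x - y) * (y - z) * ((q * x - z) * f12 + (1 - q) * z * f1) 
       + (1 - q) * y * (x - z) * ((q * y - z) * f2 + (1 - q) * z * f)))"
  by (simp add: algebra_simps)

lemma swap_braid: 
  "swap_vars (Suc i) (swap_vars i (swap_vars (Suc i) f)) = swap_vars i (swap_vars (Suc i) (swap_vars i f))"
proof (induction f rule: pm_induct[where A = UNIV])
  case (3 m c)
  have "tr (Suc i) \<circ> tr i \<circ> tr (Suc i) = tr i \<circ> tr (Suc i) \<circ> tr i" by (auto simp: transpose_def fun_eq_iff)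
  thus ?case by (simp add: map_key_compose o_assoc inj_compose)
qed auto

lemma var_neq': "i \<noteq> j \<Longrightarrow> var i - var j \<noteq> 0"
proof
  assume "i \<noteq> j" "var i - var j = 0"
  hence "lkp (var i) (sgl i 1) = lkp (var j) (sgl i 1)" by simp
  thus False using \<open>i \<noteq> j\<close> by (auto simp: var_def lookup_single when_def dest!: arg_cong[where f = "\<lambda>m. lkp m i"] split: if_splits)
qed

lemma hecke_braid:
  assumes i: "i \<in> {1..<n}" and j: "Suc i \<in> {1..<n}" and f: "f \<in> carrier (pol_ring n)"
  shows "hecke_op i (hecke_op (Suc i) (hecke_op i f)) = hecke_op (Suc i) (hecke_op i (hecke_op (Suc i) f))"
proof -
  have [simp]: "tr i (Suc (Suc i)) = Suc (Suc i)" "tr (Suc i) i = i" 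
    by (auto simp: transpose_def)
  note c = hecke_op_closed
  note m = hecke_op_mult
  note s = hecke_op_mono[where n = n]
  let ?x = "var i" let ?y = "var (Suc i)" let ?z = "var (Suc (Suc i))"
  let ?T = "hecke_op i" let ?U = "hecke_op (Suc i)"
  have A: "(?x - ?z) * swap_vars i (?U (?T f)) = (const qpar * ?x - ?z) * swap_vars i (swap_vars (Suc i) (?T f)) + (1 - const qpar) * ?z * swap_vars i (?T f)"
    using s[OF j c[OF i f], of i] by simp
  have B: "(?x - ?z) * swap_vars (Suc i) (?T (?U f)) = (const qpar * ?x - ?z) * swap_vars (Suc i) (swap_vars i (?U f)) + (1 - const qpar) * ?z * swap_vars (Suc i) (?U f)"
    using s[OF i c[OF j f], of "Suc i"] by simp
  have h1: "(?y - ?x) * swap_vars i (?T f) = (const qpar * ?y - ?x) * f + (1 - const qpar) * ?x * swap_vars i f"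
    using s[OF i f, of i] by simp
  have h2: "(?x - ?z) * swap_vars (Suc i) (?T f) = (const qpar * ?x - ?z) * swap_vars (Suc i) (swap_vars i f) + (1 - const qpar) * ?z * swap_vars (Suc i) f"
    using s[OF i f, of "Suc i"] by simp
  have h12: "(?y - ?z) * swap_vars i (swap_vars (Suc i) (?T f)) = (const qpar * ?y - ?z) * swap_vars i (swap_vars (Suc i) (swap_vars i f)) + (1 - const qpar) * ?z * swap_vars i (swap_vars (Suc i) f)"
    using arg_cong[OF h2, of "swap_vars i"] by (simp add: swap_const[of _ 1, simplified])
  have k2: "(?z - ?y) * swap_vars (Suc i) (?U f) = (const qpar * ?z - ?y) * f + (1 - const qpar) * ?y * swap_vars (Suc i) f"
    using s[OF j f, of "Suc i"] by simp
  have k1: "(?x - ?z) * swap_vars i (?U f) = (const qpar * ?x - ?z) * swap_vars i (swap_vars (Suc i) f) + (1 - const qpar) * ?z * swap_vars i f"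
    using s[OF j f, of i] by simp
  have k21: "(?x - ?y) * swap_vars (Suc i) (swap_vars i (?U f)) = (const qpar * ?x - ?y) * swap_vars i (swap_vars (Suc i) (swap_vars i f)) + (1 - const qpar) * ?y * swap_vars (Suc i) (swap_vars i f)"
    using arg_cong[OF k1, of "swap_vars (Suc i)"] by (simp add: swap_const[of _ 1, simplified] swap_braid)
  have "(?y - ?z) * ((?x - ?y) * (?x - ?y) * (?y - ?z) * (?x - ?z) * ?T (?U (?T f)))
    = (?x - ?y) * ((?y - ?z) * (?y - ?z) * (?x - ?y) * (?x - ?z) * ?U (?T (?U f)))"
    unfolding braid_aux1[OF m[OF i c[OF j c[OF i f]]] m[OF j c[OF i f]] A m[OF i f] h1 h2 h12]
     braid_aux2[OF m[OF j c[OF i c[OF j f]]] m[OF i c[OF j f]] B m[OF j f] k2 k1 k21]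
    by (rule braid_aux3)
  hence "((?x - ?y) * (?x - ?y) * (?y - ?z) * (?y - ?z) * (?x - ?z)) * ?T (?U (?T f))
    = ((?x - ?y) * (?x - ?y) * (?y - ?z) * (?y - ?z) * (?x - ?z)) * ?U (?T (?U f))"
    by (simp only: ac_simps)
  thus ?thesis by (subst (asm) mult_left_cancel) (use var_neq' in auto)
qed


section \<open>The generating function of the Hall-Littlewood polynomials\<close>

lemma hl_geom: "(1 - fps_const x * fps_X) * Abs_fps (\<lambda>m. x ^ m) = 1" for x :: "'a::comm_ring_1"
proof (rule fps_ext)
  fix n show "fps_nth ((1 - fps_const x * fps_X) * Abs_fps (\<lambda>m. x ^ m)) n = fps_nth 1 n"
    by (cases n) (simp_all add: left_diff_distrib mult.assoc)
qed

lemma qpar_neq: "1 - qpar \<noteq> 0"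
  by (simp add: qpar_def One_fract_def Zero_fract_def eq_fract one_pCons)

lemma hall_littlewood_gf:
  "Abs_fps (\<lambda>d. const (1 - qpar) * hall_littlewood d i) *
     (\<Prod>j = 1..i. 1 - fps_const (var j) * fps_X)
   = (\<Prod>j = 1..i. 1 - fps_const (const qpar * var j) * fps_X)"
proof -
  have "const (1 - qpar) * const (inverse (1 - qpar)) = 1"
    using qpar_neq by (simp add: const_mult[symmetric])
  hence "Abs_fps (\<lambda>d. const (1 - qpar) * hall_littlewood d i) = hall_littlewood_series i"
    by (simp add: hall_littlewood_def fps_eq_iff mult.assoc[symmetric])
  moreover have "(1 - fps_const (const qpar * var j) * fps_X) * Abs_fps (\<lambda>m. var j ^ m) * (1 - fps_const (var j) * fps_X)
     = 1 - fps_const (const qpar * var j) * fps_X" for j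
  proof -
    have "(1 - fps_const (const qpar * var j) * fps_X) * Abs_fps (\<lambda>m. var j ^ m) * (1 - fps_const (var j) * fps_X)
      = (1 - fps_const (const qpar * var j) * fps_X) * ((1 - fps_const (var j) * fps_X) * Abs_fps (\<lambda>m. var j ^ m))"
      by (simp only: ac_simps)
    thus ?thesis by (simp only: hl_geom mult_1_right)
  qed
  ultimately show ?thesis
    by (simp only: hall_littlewood_series_def prod.distrib[symmetric])
qed

section \<open>Well-definedness of the action of the Hecke algebra\<close>


lemma free_simps [simp]:
  "mult (free_alg_ring n) = (*)" "one (free_alg_ring n) = 1" "zero (free_alg_ring n) = 0" "add (free_alg_ring n) = (+)"
  by (simp_all add: free_alg_ring_def)

abbreviation (input) "wds n \<equiv> {w. set (letters w) \<subseteq> {1..<n}}"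

lemma mem_free: "a \<in> carrier (free_alg_ring n) \<longleftrightarrow> Poly_Mapping.keys a \<subseteq> wds n"
  by (auto simp: free_alg_ring_def)

lemma free_0 [simp]: "0 \<in> carrier (free_alg_ring n)" and free_1 [simp]: "1 \<in> carrier (free_alg_ring n)"
  and free_scalar [simp]: "fscalar c \<in> carrier (free_alg_ring n)"
  by (auto simp: mem_free fscalar_def zero_word_def)
lemma free_gen: "i \<in> {1..<n} \<Longrightarrow> fgen i \<in> carrier (free_alg_ring n)"
  by (auto simp: mem_free fgen_def)
lemma free_add: "a \<in> carrier (free_alg_ring n) \<Longrightarrow> b \<in> carrier (free_alg_ring n) \<Longrightarrow> a + b \<in> carrier (free_alg_ring n)"
  using Poly_Mapping.keys_add[of a b] unfolding mem_free by blast
lemma free_uminus: "a \<in> carrier (free_alg_ring n) \<Longrightarrow> - a \<in> carrier (free_alg_ring n)"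
  by (simp add: mem_free)
lemma free_diff: "a \<in> carrier (free_alg_ring n) \<Longrightarrow> b \<in> carrier (free_alg_ring n) \<Longrightarrow> a - b \<in> carrier (free_alg_ring n)"
  using free_add[OF _ free_uminus, of a n b] by simp
lemma free_mult: "a \<in> carrier (free_alg_ring n) \<Longrightarrow> b \<in> carrier (free_alg_ring n) \<Longrightarrow> a * b \<in> carrier (free_alg_ring n)"
  unfolding mem_free
proof
  fix m assume "Poly_Mapping.keys a \<subseteq> wds n" "Poly_Mapping.keys b \<subseteq> wds n"
    "m \<in> Poly_Mapping.keys (a * b)"
  then obtain v w where "m = v + w" "v \<in> wds n" "w \<in> wds n"
    using keys_mult[of a b] by blast
  thus "m \<in> wds n" by (auto simp: plus_word_def)
qed

lemma free_ring: "ring (free_alg_ring n)"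
proof (rule ringI)
  show "abelian_group (free_alg_ring n)"
  proof (rule abelian_groupI)
    show "\<exists>y\<in>carrier (free_alg_ring n). y \<oplus>\<^bsub>free_alg_ring n\<^esub> x = \<zero>\<^bsub>free_alg_ring n\<^esub>" if "x \<in> carrier (free_alg_ring n)" for x
      using free_uminus[OF that] by (intro bexI[of _ "- x"]) auto
  qed (simp_all add: free_add add.assoc add.commute)
  show "monoid (free_alg_ring n)"
    by (rule monoidI) (simp_all add: free_mult mult.assoc)
qed (simp_all add: distrib_right distrib_left)

lemma free_act_superset:
  assumes "finite S" "Poly_Mapping.keys a \<subseteq> S"
  shows "free_act a f = (\<Sum>w\<in>S. const (lkp a w) * foldr hecke_op (letters w) f)"
  unfolding free_act_def using assms by (intro sum.mono_neutral_left) (auto simp: in_keys_iff)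

lemma free_act_add [simp]: "free_act (a + b) f = free_act a f + free_act b f"
proof -
  let ?S = "Poly_Mapping.keys a \<union> Poly_Mapping.keys b"
  have "Poly_Mapping.keys (a + b) \<subseteq> ?S" by (rule Poly_Mapping.keys_add)
  thus ?thesis
    by (simp add: free_act_superset[of ?S] lookup_add const_add distrib_right sum.distrib)
qed

lemma free_act_0 [simp]: "free_act 0 f = 0" by (simp add: free_act_def)
lemma free_act_diff [simp]: "free_act (a - b) f = free_act a f - free_act b f"
  using free_act_add[of "a - b" b f] by (simp del: free_act_add)
lemma free_act_single: "free_act (sgl w c) f = const c * foldr hecke_op (letters w) f"
  using free_act_superset[of "{w}" "sgl w c" f] by simp

lemma word_act_closed:
  "set u \<subseteq> {1..<n} \<Longrightarrow> f \<in> carrier (pol_ring n) \<Longrightarrow> foldr hecke_op u f \<in> carrier (pol_ring n)"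
  by (induction u) (auto intro!: hecke_op_closed simp del: atLeastLessThan_iff)
lemma word_act_add:
  "set u \<subseteq> {1..<n} \<Longrightarrow> f \<in> carrier (pol_ring n) \<Longrightarrow> g \<in> carrier (pol_ring n) 
   \<Longrightarrow> foldr hecke_op u (f + g) = foldr hecke_op u f + foldr hecke_op u g"
  by (induction u) (auto simp: hecke_op_add[of _ n] word_act_closed simp del: atLeastLessThan_iff)
lemma word_act_const:
  "set u \<subseteq> {1..<n} \<Longrightarrow> f \<in> carrier (pol_ring n)  
   \<Longrightarrow> foldr hecke_op u (const c * f) = const c * foldr hecke_op u f"
  by (induction u) (auto simp: hecke_op_const[of _ n] word_act_closed simp del: atLeastLessThan_iff)

lemma free_act_closed:
  "a \<in> carrier (free_alg_ring n) \<Longrightarrow> f \<in> carrier (pol_ring n) \<Longrightarrow> free_act a f \<in> carrier (pol_ring n)"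
  unfolding mem_free[of a]
  by (rule pm_induct[of a "wds n" "\<lambda>a. free_act a f \<in> carrier (pol_ring n)"]) 
     (auto simp: free_act_single pol_add intro!: pol_mult word_act_closed)

lemma free_act_radd:
  "a \<in> carrier (free_alg_ring n) \<Longrightarrow> f \<in> carrier (pol_ring n) \<Longrightarrow> g \<in> carrier (pol_ring n) \<Longrightarrow> free_act a (f + g) = free_act a f + free_act a g"
  unfolding mem_free[of a]
  by (rule pm_induct[of a "wds n" "\<lambda>a. free_act a (f + g) = free_act a f + free_act a g"]) 
     (simp_all add: free_act_single word_act_add[of _ n] distrib_left)

lemma free_act_mult:
  assumes "a \<in> carrier (free_alg_ring n)" "b \<in> carrier (free_alg_ring n)" "f \<in> carrier (pol_ring n)"
  shows "free_act (a * b) f = free_act a (free_act b f)"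
proof -
  have 1: "free_act (sgl v c * sgl w d) f = free_act (sgl v c) (free_act (sgl w d) f)" if "v \<in> wds n" "w \<in> wds n" for v w c d
    using that assms by (simp add: mult_single free_act_single word_act_const[of _ n] word_act_closed plus_word_def const_mult mult.assoc)
  have s: "sgl v c \<in> carrier (free_alg_ring n)" if "v \<in> wds n" for v c
    using that by (auto simp: mem_free)
  have "free_act (sgl v c * b) f = free_act (sgl v c) (free_act b f) \<and> Poly_Mapping.keys b \<subseteq> wds n" if v: "v \<in> wds n" for v c
    using assms(2) unfolding mem_free
  proof (rule pm_induct[of b "wds n" "\<lambda>b. free_act (sgl v c * b) f = free_act (sgl v c) (free_act b f) \<and> Poly_Mapping.keys b \<subseteq> wds n"]; (elim conjE)?)
    fix g h assume g: "free_act (sgl v c * g) f = free_act (sgl v c) (free_act g f)" "free_act (sgl v c * h) f = free_act (sgl v c) (free_act h f)"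
     and k: "Poly_Mapping.keys g \<subseteq> wds n" "Poly_Mapping.keys h \<subseteq> wds n"
    show "free_act (sgl v c * (g + h)) f = free_act (sgl v c) (free_act (g + h) f) \<and> Poly_Mapping.keys (g + h) \<subseteq> wds n"
    proof
      have "g \<in> carrier (free_alg_ring n)" "h \<in> carrier (free_alg_ring n)" using k by (simp_all only: mem_free)
      thus "free_act (sgl v c * (g + h)) f = free_act (sgl v c) (free_act (g + h) f)" 
        by (simp add: distrib_left g free_act_radd[OF s[OF v]] free_act_closed[OF _ assms(3)])
      show "Poly_Mapping.keys (g + h) \<subseteq> wds n" using k Poly_Mapping.keys_add[of g h] by blast
    qed
  next
    have "foldr hecke_op (letters v) 0 = 0" using word_act_const[of "letters v" n 0 0] v by simp
    thus "free_act (sgl v c * 0) f = free_act (sgl v c) (free_act 0 f) \<and> Poly_Mapping.keys (0 :: free_alg) \<subseteq> wds n"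
      by (simp add: free_act_single)
  qed (use 1 v in \<open>auto\<close>)
  hence 2: "free_act (sgl v c * b) f = free_act (sgl v c) (free_act b f)" if v: "v \<in> wds n" for v c using that by blast
  show ?thesis using assms(1) unfolding mem_free
    by (rule pm_induct[of a "wds n" "\<lambda>a. free_act (a * b) f = free_act a (free_act b f)"]) (simp_all add: 2 distrib_right)
qed

lemma free_act_1 [simp]: "free_act 1 f = f"
  using free_act_single[of 0 1 f] by (simp, simp add: zero_word_def)
lemma free_act_scalar [simp]: "free_act (fscalar c) f = const c * f"
  by (simp add: free_act_single zero_word_def fscalar_def)
lemma free_act_gen [simp]: "free_act (fgen i) f = hecke_op i f"
  by (simp add: free_act_single fgen_def)

definition "fker n = {a \<in> carrier (free_alg_ring n). \<forall>f \<in> carrier (pol_ring n). free_act a f = 0}"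

lemma fker_ideal: "ideal (fker n) (free_alg_ring n)"
proof (rule idealI[OF free_ring])
  show "subgroup (fker n) (add_monoid (free_alg_ring n))"
  proof (rule group.subgroupI[OF abelian_group.a_group[OF ring.is_abelian_group[OF free_ring]]])
    show "inv\<^bsub>add_monoid (free_alg_ring n)\<^esub> a \<in> fker n" if a: "a \<in> fker n" for a
    proof -
      have "inv\<^bsub>add_monoid (free_alg_ring n)\<^esub> a = - a" using a free_uminus[of a n]
        by (intro group.inv_equality[OF abelian_group.a_group[OF ring.is_abelian_group[OF free_ring]]])
          (auto simp: fker_def)
      thus ?thesis using a free_uminus[of a n] free_act_diff[of 0 a] by (auto simp: fker_def simp del: free_act_diff)
    qed
    have "0 \<in> fker n" by (simp add: fker_def)
    thus "fker n \<noteq> {}" by blast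
  qed (auto simp: fker_def free_add)
next
  fix a x assume a: "a \<in> fker n" "x \<in> carrier (free_alg_ring n)"
  have "free_act x 0 = 0" using free_act_radd[of x n 0 0] a by simp
  thus "x \<otimes>\<^bsub>free_alg_ring n\<^esub> a \<in> fker n" "a \<otimes>\<^bsub>free_alg_ring n\<^esub> x \<in> fker n"
    using a by (auto simp: fker_def free_mult free_act_mult[of _ n] free_act_closed)
qed

lemma relations_fker: "hecke_relations n \<subseteq> fker n"
proof
  fix r assume "r \<in> hecke_relations n"
  then consider i where "i \<in> {1..<n}" "r = (fgen i + 1) * (fgen i - fscalar qpar)"
    | i j where "i \<in> {1..<n}" "j \<in> {1..<n}" "\<bar>int i - int j\<bar> > 1" "r = fgen i * fgen j - fgen j * fgen i"
    | i where "i \<in> {1..<n}" "Suc i \<in> {1..<n}" "r = fgen i * fgen (Suc i) * fgen i - fgen (Suc i) * fgen i * fgen (Suc i)"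
    unfolding hecke_relations_def by fastforce
  thus "r \<in> fker n"
  proof cases
    case 1
    have "free_act r f = 0" if f: "f \<in> carrier (pol_ring n)" for f
    proof -
      have "hecke_op i (hecke_op i f - const qpar * f) = hecke_op i (hecke_op i f + const (- qpar) * f)"
        using const_diff[of 0 qpar] by simp
      also have "\<dots> = hecke_op i (hecke_op i f) - const qpar * hecke_op i f"
        using const_diff[of 0 qpar] 
        by (simp only: hecke_op_add[OF 1(1) hecke_op_closed[OF 1(1) f] pol_mult[OF pol_const f]] hecke_op_const[OF 1(1) f]) simp
      finally have e: "hecke_op i (hecke_op i f - const qpar * f) = hecke_op i (hecke_op i f) - const qpar * hecke_op i f" .
      have "free_act r f = free_act (fgen i + 1) (free_act (fgen i - fscalar qpar) f)" unfolding 1(2)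
        by (rule free_act_mult[of _ n]) (auto intro!: free_add free_diff free_gen 1(1) f)
      also have "\<dots> = hecke_op i (hecke_op i f) - const qpar * hecke_op i f + (hecke_op i f - const qpar * f)"
        by (simp add: e)
      also have "\<dots> = 0" unfolding hecke_quad[OF 1(1) f] by (simp add: algebra_simps)
      finally show ?thesis .
    qed
    moreover have "r \<in> carrier (free_alg_ring n)" unfolding 1(2)
      by (auto intro!: free_mult free_add free_diff free_gen 1(1))
    ultimately show ?thesis by (simp add: fker_def)
  next
    case 2
    note g = free_gen[OF 2(1)] free_gen[OF 2(2)]
    have ij: "j \<noteq> i" "j \<noteq> Suc i" "i \<noteq> Suc j" using 2(3) by auto
    have "free_act r f = 0" if f: "f \<in> carrier (pol_ring n)" for f
      unfolding 2(4) free_act_diff free_act_mult[OF g(1) g(2) f] free_act_mult[OF g(2) g(1) f] free_act_gen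
        hecke_commute[OF 2(1,2) f ij] by simp
    moreover have "r \<in> carrier (free_alg_ring n)" unfolding 2(4)
      by (intro free_mult free_diff g)
    ultimately show ?thesis by (simp add: fker_def)
  next
    case 3
    note g = free_gen[OF 3(1)] free_gen[OF 3(2)]
    have "free_act r f = 0" if f: "f \<in> carrier (pol_ring n)" for f
    proof -
      have "free_act (fgen i * fgen (Suc i) * fgen i) f = hecke_op i (hecke_op (Suc i) (hecke_op i f))"
        by (simp add: free_act_mult[OF free_mult[OF g] g(1) f] free_act_mult[OF g hecke_op_closed[OF 3(1) f]])
      moreover have "free_act (fgen (Suc i) * fgen i * fgen (Suc i)) f = hecke_op (Suc i) (hecke_op i (hecke_op (Suc i) f))"
        by (simp add: free_act_mult[OF free_mult[OF g(2,1)] g(2) f] free_act_mult[OF g(2,1) hecke_op_closed[OF 3(2) f]])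
      ultimately show ?thesis unfolding 3(3) free_act_diff using hecke_braid[OF 3(1,2) f] by simp
    qed
    moreover have "r \<in> carrier (free_alg_ring n)" unfolding 3(3)
      by (intro free_mult free_diff g)
    ultimately show ?thesis by (simp add: fker_def)
  qed
qed

abbreviation (input) "hrel_ideal n \<equiv> Idl\<^bsub>free_alg_ring n\<^esub> (hecke_relations n)"

lemma hrel_fker: "hrel_ideal n \<subseteq> fker n"
  by (rule ring.genideal_minimal[OF free_ring fker_ideal relations_fker])

lemma hrel_ideal: "ideal (hrel_ideal n) (free_alg_ring n)"
  using relations_fker by (intro ring.genideal_ideal[OF free_ring]) (auto simp: fker_def)

lemma hecke_act_coset:
  assumes a: "a \<in> carrier (free_alg_ring n)" and f: "f \<in> carrier (pol_ring n)"
  shows "hecke_act (hrel_ideal n +>\<^bsub>free_alg_ring n\<^esub> a) f = free_act a f"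
proof -
  have "0 \<in> hrel_ideal n" using additive_subgroup.zero_closed[OF ideal.axioms(1)[OF hrel_ideal]] by simp
  hence "a \<in> hrel_ideal n +>\<^bsub>free_alg_ring n\<^esub> a" by (auto simp: a_r_coset_def' intro: bexI[of _ 0])
  moreover have "free_act b f = free_act a f" if b: "b \<in> hrel_ideal n +>\<^bsub>free_alg_ring n\<^esub> a" for b
  proof -
    from b obtain r where r: "r \<in> hrel_ideal n" "b = r + a" by (auto simp: a_r_coset_def')
    hence "free_act r f = 0" using hrel_fker[of n] f by (auto simp: fker_def)
    thus ?thesis by (simp add: r)
  qed
  ultimately have "(\<lambda>b. free_act b f) ` (hrel_ideal n +>\<^bsub>free_alg_ring n\<^esub> a) = {free_act a f}" by blast
  thus ?thesis by (simp add: hecke_act_def)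
qed

lemma hecke_algebra_carrier:
  "carrier (hecke_algebra n) = {hrel_ideal n +>\<^bsub>free_alg_ring n\<^esub> a | a. a \<in> carrier (free_alg_ring n)}"
  by (auto simp: hecke_algebra_def FactRing_def A_RCOSETS_def')

lemma left_module_pol_ring: "left_module (hecke_algebra n) (pol_ring n) hecke_act"
proof -
  note I = hrel_ideal[of n]
  interpret ideal "hrel_ideal n" "free_alg_ring n" by (rule I)
  have R: "ring (hecke_algebra n)" unfolding hecke_algebra_def by (rule ideal.quotient_is_ring[OF I])
  have M: "abelian_group (pol_ring n)" using pol_cring by (simp add: cring_def ring_def)
  have add: "(hrel_ideal n +>\<^bsub>free_alg_ring n\<^esub> a) \<oplus>\<^bsub>hecke_algebra n\<^esub> (hrel_ideal n +>\<^bsub>free_alg_ring n\<^esub> b) = hrel_ideal n +>\<^bsub>free_alg_ring n\<^esub> (a + b)"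
    if "a \<in> carrier (free_alg_ring n)" "b \<in> carrier (free_alg_ring n)" for a b
    using a_rcos_sum[OF that] by (simp add: hecke_algebra_def FactRing_def)
  have mult: "(hrel_ideal n +>\<^bsub>free_alg_ring n\<^esub> a) \<otimes>\<^bsub>hecke_algebra n\<^esub> (hrel_ideal n +>\<^bsub>free_alg_ring n\<^esub> b) = hrel_ideal n +>\<^bsub>free_alg_ring n\<^esub> (a * b)"
    if "a \<in> carrier (free_alg_ring n)" "b \<in> carrier (free_alg_ring n)" for a b
    using ideal.rcoset_mult_add[OF I that] by (simp add: hecke_algebra_def FactRing_def)
  have C: "\<exists>a \<in> carrier (free_alg_ring n). h = hrel_ideal n +>\<^bsub>free_alg_ring n\<^esub> a" if "h \<in> carrier (hecke_algebra n)" for h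
    using that by (auto simp: hecke_algebra_carrier)
  show ?thesis
  proof (intro left_module.intro left_module_axioms.intro R M, goal_cases)
    case (1 h x) thus ?case using C[of h] by (auto simp: hecke_act_coset free_act_closed)
  next
    case (2 h k x) thus ?case using C[of h] C[of k] by (auto simp: hecke_act_coset add free_add)
  next
    case (3 h x y) thus ?case using C[of h] by (auto simp: hecke_act_coset pol_add free_act_radd[of _ n])
  next
    case (4 h k x) thus ?case using C[of h] C[of k] by (auto simp: hecke_act_coset mult free_mult free_act_mult[of _ n] free_act_closed)
  next
    case (5 x) thus ?case using hecke_act_coset[of 1 n x] by (simp add: hecke_algebra_def FactRing_def)
  qed
qed

end

theory Submission
  imports Defs
begin

text \<open>
  The operators \<open>T\<^sub>i\<close> are not linear over the polynomial ring, but they satisfy a twisted Leibniz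
  rule (\<open>hecke_op_leibniz\<close>)
  \[ T_i(fg) = s_i(f)\, T_i(g) + (1-q)\, x_{i+1}\, \partial_i(f)\, g. \]
  Both coefficients \<open>s\<^sub>i(f)\<close> and \<open>(1-q) x\<^sub>i\<^sub>+\<^sub>1 \<partial>\<^sub>i(f)\<close> are polynomials. Therefore an ideal is stable
  under \<open>T\<^sub>i\<close> as soon as \<open>T\<^sub>i\<close> maps its generators into it (\<open>hecke_op_genideal\<close>).

  A polynomial fixed by \<open>s\<^sub>i\<close> is multiplied by \<open>q\<close> under \<open>T\<^sub>i\<close>. This settles the elementary symmetric
  polynomials and all \<open>P\<^sub>k(x\<^sub>1,\<dots>,x\<^sub>j)\<close> with \<open>j \<noteq> i\<close>. The remaining generator is covered by the
  three-term relation (\<open>hecke_op_hall_littlewood\<close>)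
  \[ T_i P_k(x_1,\dots,x_i) = P_k(x_1,\dots,x_{i+1}) - P_k(x_1,\dots,x_i) + q\, P_k(x_1,\dots,x_{i-1}). \]
  On generating functions, after division by the common factor for \<open>x\<^sub>1,\<dots>,x\<^sub>i\<^sub>-\<^sub>1\<close>, it is an
  identity between rational functions of \<open>x\<^sub>i\<close>, \<open>x\<^sub>i\<^sub>+\<^sub>1\<close> and \<open>t\<close>. The right-hand side stays in the
  ideal: \<open>i + 1 \<le> n\<close>, and for \<open>i = 1\<close> the last term is \<open>P\<^sub>k\<close> in no variables, which vanishes because
  \<open>k \<ge> 1\<close>.

  For the grading, the ideal has homogeneous generators and hence contains the homogeneous components
  of its elements (\<open>hcomp_genideal\<close>), while \<open>T\<^sub>i\<close> commutes with taking homogeneous components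
  (\<open>hcomp_hecke_op\<close>). So the decomposition of a polynomial into components descends to the quotient,
  uniquely, and the action respects it.
\<close>

section \<open>Homogeneous components\<close>

definition wdeg :: "(nat \<Rightarrow>\<^sub>0 nat) \<Rightarrow> nat" where
  "wdeg m = (\<Sum>j \<in> Poly_Mapping.keys m. lkp m j)"

lemma wdeg_0 [simp]: "wdeg 0 = 0"
  by (simp add: wdeg_def)

lemma wdeg_superset:
  "finite S \<Longrightarrow> Poly_Mapping.keys m \<subseteq> S \<Longrightarrow> wdeg m = (\<Sum>j \<in> S. lkp m j)"
  unfolding wdeg_def by (intro sum.mono_neutral_left) (auto simp: in_keys_iff)

lemma wdeg_add [simp]: "wdeg (a + b) = wdeg a + wdeg b"
proof -
  let ?S = "Poly_Mapping.keys a \<union> Poly_Mapping.keys b"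
  have "Poly_Mapping.keys (a + b) \<subseteq> ?S" by (rule Poly_Mapping.keys_add)
  thus ?thesis
    by (simp add: wdeg_superset[of ?S] lookup_add sum.distrib)
qed

lemma wdeg_trm [simp]: "wdeg (trm i m) = wdeg m"
proof -
  have "wdeg (trm i m) = (\<Sum>j \<in> tr i ` Poly_Mapping.keys m. lkp m (tr i j))"
    by (auto simp: wdeg_def keys_map_key map_key.rep_eq bij_vimage_eq_inv_image)
  also have "\<dots> = wdeg m"
    by (subst sum.reindex) (auto simp: wdeg_def intro: inj_on_subset[OF inj_tr])
  finally show ?thesis .
qed

lemma homogeneous_wdeg: "homogeneous d f \<longleftrightarrow> Poly_Mapping.keys f \<subseteq> {m. wdeg m = d}"
  by (auto simp: homogeneous_def wdeg_def)

lemma homogeneous_add: "homogeneous d f \<Longrightarrow> homogeneous d g \<Longrightarrow> homogeneous d (f + g)"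
  using Poly_Mapping.keys_add[of f g] unfolding homogeneous_wdeg by blast

lemma homogeneous_diff: "homogeneous d f \<Longrightarrow> homogeneous d g \<Longrightarrow> homogeneous d (f - g)"
  using homogeneous_add[of d f "- g"] by (simp add: homogeneous_wdeg)

lemma homogeneous_0 [simp]: "homogeneous d 0"
  and homogeneous_single: "homogeneous (wdeg m) (sgl m c)"
  and homogeneous_const [simp]: "homogeneous 0 (const c)"
  and homogeneous_1 [simp]: "homogeneous 0 1"
  and homogeneous_var [simp]: "homogeneous 1 (var j)"
  by (auto simp: homogeneous_wdeg const_def var_def wdeg_def)

lemma homogeneous_mult:
  assumes "homogeneous d f" "homogeneous e g"
  shows "homogeneous (d + e) (f * g)"
  unfolding homogeneous_wdeg
proof
  fix m assume "m \<in> Poly_Mapping.keys (f * g)"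
  then obtain a b where "m = a + b" "a \<in> Poly_Mapping.keys f" "b \<in> Poly_Mapping.keys g"
    using keys_mult[of f g] by blast
  thus "m \<in> {m. wdeg m = d + e}" using assms by (auto simp: homogeneous_wdeg)
qed

lemma homogeneous_const_mult: "homogeneous d f \<Longrightarrow> homogeneous d (const c * f)"
  using homogeneous_mult[OF homogeneous_const] by simp

lemma homogeneous_sum: "(\<And>a. a \<in> A \<Longrightarrow> homogeneous d (f a)) \<Longrightarrow> homogeneous d (sum f A)"
  by (induction A rule: infinite_finite_induct) (auto intro: homogeneous_add)

definition hcomp :: "nat \<Rightarrow> mpol \<Rightarrow> mpol" where
  "hcomp d f = Abs_poly_mapping (\<lambda>m. lkp f m when wdeg m = d)"

lemma lookup_hcomp: "lkp (hcomp d f) m = (lkp f m when wdeg m = d)"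
proof -
  have "finite {m. (lkp f m when wdeg m = d) \<noteq> 0}"
    by (rule finite_subset[OF _ finite_lookup[of f]]) auto
  thus ?thesis by (simp add: hcomp_def lookup_Abs_poly_mapping)
qed

lemma keys_hcomp: "Poly_Mapping.keys (hcomp d f) = {m \<in> Poly_Mapping.keys f. wdeg m = d}"
  by (auto simp: in_keys_iff lookup_hcomp)

lemma hcomp_0 [simp]: "hcomp d 0 = 0"
  and hcomp_add [simp]: "hcomp d (f + g) = hcomp d f + hcomp d g"
  and hcomp_diff [simp]: "hcomp d (f - g) = hcomp d f - hcomp d g"
  and hcomp_single: "hcomp d (sgl m c) = (if wdeg m = d then sgl m c else 0)"
  by (auto intro!: poly_mapping_eqI simp: lookup_hcomp lookup_add lookup_minus lookup_single when_def)

lemma hcomp_sum: "hcomp d (sum f A) = (\<Sum>a\<in>A. hcomp d (f a))"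
  by (induction A rule: infinite_finite_induct) auto

lemma hcomp_closed: "f \<in> carrier (pol_ring n) \<Longrightarrow> hcomp d f \<in> carrier (pol_ring n)"
  by (auto simp: mem_pol keys_hcomp)

lemma homogeneous_hcomp [simp]: "homogeneous d (hcomp d f)"
  by (auto simp: homogeneous_wdeg keys_hcomp)

lemma hcomp_homogeneous:
  "homogeneous e f \<Longrightarrow> hcomp d f = (if d = e then f else 0)"
  by (auto intro!: poly_mapping_eqI simp: homogeneous_wdeg lookup_hcomp when_def in_keys_iff)

lemma sum_hcomp:
  assumes "finite D" "\<And>d. d \<notin> D \<Longrightarrow> hcomp d f = 0"
  shows "(\<Sum>d\<in>D. hcomp d f) = f"
proof (rule poly_mapping_eqI)
  fix m
  have "lkp f m = 0" if "wdeg m \<notin> D"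
    using arg_cong[OF assms(2)[OF that], of "\<lambda>g. lkp g m"] by (simp add: lookup_hcomp)
  thus "lkp (\<Sum>d\<in>D. hcomp d f) m = lkp f m"
    using assms(1) by (auto simp: lookup_sum lookup_hcomp when_def sum.delta)
qed

lemma finite_hcomp: "finite {d. hcomp d f \<noteq> 0}"
proof (rule finite_subset)
  show "{d. hcomp d f \<noteq> 0} \<subseteq> wdeg ` Poly_Mapping.keys f"
    using keys_hcomp[of _ f] by (auto simp flip: keys_eq_empty)
qed simp

text \<open>
  Multiplication by a homogeneous polynomial of degree \<open>e\<close> shifts components by \<open>e\<close>; the case
  distinction is needed because subtraction of natural numbers truncates.
\<close>

lemma hcomp_mult:
  assumes "homogeneous e g"
  shows "hcomp d (g * f) = (if e \<le> d then g * hcomp (d - e) f else 0)"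
proof -
  have 1: "hcomp d (sgl m c * f) = (if e \<le> d then sgl m c * hcomp (d - e) f else 0)"
    if "wdeg m = e" for m c
  proof (induction f rule: pm_induct[where A = UNIV])
    case (3 l b)
    show ?case using that by (auto simp: mult_single hcomp_single)
  qed (auto simp: distrib_left)
  show ?thesis
    using assms unfolding homogeneous_wdeg
    by (rule pm_induct) (auto simp: 1 distrib_right)
qed

lemma hcomp_const_mult: "hcomp d (const c * f) = const c * hcomp d f"
  by (simp add: hcomp_mult[OF homogeneous_const])

lemma hcomp_swap: "hcomp d (swap_vars i f) = swap_vars i (hcomp d f)"
  by (induction f rule: pm_induct[where A = UNIV]) (auto simp: hcomp_single)

text \<open>
  The polynomial \<open>T\<^sub>i.f\<close> is characterised by the value of \<open>(x\<^sub>i - x\<^sub>i\<^sub>+\<^sub>1) T\<^sub>i.f\<close>, in which \<open>f\<close> and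
  \<open>s\<^sub>i.f\<close> occur with coefficients of degree 1. Comparing the components of degree \<open>d + 1\<close> there
  avoids computing with divided differences.
\<close>

lemma hcomp_hecke_op:
  assumes i: "i \<in> {1..<n}" and f: "f \<in> carrier (pol_ring n)"
  shows "hcomp d (hecke_op i f) = hecke_op i (hcomp d f)"
proof (rule hecke_op_eqI[OF i hcomp_closed[OF f], symmetric])
  have lin: "hcomp (Suc d) (g * h) = g * hcomp d h" if "homogeneous 1 g" for g h
    using hcomp_mult[OF that, of "Suc d"] by simp
  have c: "homogeneous 1 (const c * var j)" for c j
    by (rule homogeneous_const_mult[OF homogeneous_var])
  have e: "1 - const qpar = const (1 - qpar)" by (simp add: const_diff)
  show "(var i - var (Suc i)) * hcomp d (hecke_op i f) =
      (const qpar * var i - var (Suc i)) * swap_vars i (hcomp d f) + (1 - const qpar) * var (Suc i) * hcomp d f"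
    using arg_cong[OF hecke_op_mult[OF i f], of "hcomp (Suc d)"]
    unfolding e hcomp_add
    by (subst (asm) (1 2 3) lin) (auto intro: homogeneous_diff c simp: hcomp_swap simp del: One_nat_def)
qed

lemma hcomp_free_act:
  assumes a: "a \<in> carrier (free_alg_ring n)" and f: "f \<in> carrier (pol_ring n)"
  shows "hcomp d (free_act a f) = free_act a (hcomp d f)"
proof -
  have w: "hcomp d (foldr hecke_op u f) = foldr hecke_op u (hcomp d f)" if "set u \<subseteq> {1..<n}" for u
    using that by (induction u) (auto simp: hcomp_hecke_op[of _ n] word_act_closed f simp del: atLeastLessThan_iff)
  show ?thesis using a unfolding mem_free
    by (rule pm_induct) (auto simp: free_act_single hcomp_const_mult w)
qed

section \<open>Ideals of polynomial rings\<close>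

lemma pol_ring_ring: "ring (pol_ring n)"
  using pol_cring by (rule cring.axioms)

lemma
  assumes I: "ideal I (pol_ring n)"
  shows ideal_closed: "f \<in> I \<Longrightarrow> f \<in> carrier (pol_ring n)"
    and ideal_zero: "0 \<in> I"
    and ideal_add: "f \<in> I \<Longrightarrow> g \<in> I \<Longrightarrow> f + g \<in> I"
    and ideal_mult: "a \<in> carrier (pol_ring n) \<Longrightarrow> f \<in> I \<Longrightarrow> a * f \<in> I"
    and ideal_diff: "f \<in> I \<Longrightarrow> g \<in> I \<Longrightarrow> f - g \<in> I"
proof -
  note A = ideal.axioms(1)[OF I]
  show "f \<in> I \<Longrightarrow> f \<in> carrier (pol_ring n)"
    using additive_subgroup.a_subset[OF A] by blast
  show "0 \<in> I" using additive_subgroup.zero_closed[OF A] by simp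
  show add: "f \<in> I \<Longrightarrow> g \<in> I \<Longrightarrow> f + g \<in> I" for f g
    using additive_subgroup.a_closed[OF A] by simp
  show mult: "a \<in> carrier (pol_ring n) \<Longrightarrow> f \<in> I \<Longrightarrow> a * f \<in> I" for a f
    using ideal.I_l_closed[OF I] by simp
  show "f \<in> I \<Longrightarrow> g \<in> I \<Longrightarrow> f - g \<in> I"
    using add[of f "- 1 * g"] mult[OF pol_uminus[OF pol_1], of g] by simp
qed

lemma ideal_sum:
  "ideal I (pol_ring n) \<Longrightarrow> (\<And>a. a \<in> A \<Longrightarrow> f a \<in> I) \<Longrightarrow> sum f A \<in> I"
  by (induction A rule: infinite_finite_induct) (auto intro: ideal_zero ideal_add)

lemma pol_sum:
  "(\<And>a. a \<in> A \<Longrightarrow> f a \<in> carrier (pol_ring n)) \<Longrightarrow> sum f A \<in> carrier (pol_ring n)"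
  by (induction A rule: infinite_finite_induct) (auto intro: pol_add)

lemma pol_idealI:
  assumes "J \<subseteq> carrier (pol_ring n)" "0 \<in> J" 
    and add: "\<And>f g. f \<in> J \<Longrightarrow> g \<in> J \<Longrightarrow> f + g \<in> J"
    and mult: "\<And>a f. a \<in> carrier (pol_ring n) \<Longrightarrow> f \<in> J \<Longrightarrow> a * f \<in> J"
  shows "ideal J (pol_ring n)"
proof (rule idealI[OF pol_ring_ring])
  note G = abelian_group.a_group[OF ring.is_abelian_group[OF pol_ring_ring]]
  show "subgroup J (add_monoid (pol_ring n))"
  proof (rule group.subgroupI[OF G])
    show "inv\<^bsub>add_monoid (pol_ring n)\<^esub> f \<in> J" if f: "f \<in> J" for f
    proof -
      have m: "- f \<in> J" using mult[OF pol_uminus[OF pol_1] f] by simp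
      have "inv\<^bsub>add_monoid (pol_ring n)\<^esub> f = - f"
        using assms(1) m f by (intro group.inv_equality[OF G]) auto
      thus ?thesis using m by simp
    qed
  qed (use assms in auto)
next
  fix a x assume "a \<in> J" "x \<in> carrier (pol_ring n)"
  thus "x \<otimes>\<^bsub>pol_ring n\<^esub> a \<in> J" "a \<otimes>\<^bsub>pol_ring n\<^esub> x \<in> J"
    using mult[of x a] by (simp_all add: mult.commute[of a x])
qed

lemma mem_coset: "g \<in> I +>\<^bsub>pol_ring n\<^esub> f \<longleftrightarrow> g - f \<in> I"
  by (auto simp: a_r_coset_def' intro!: bexI[of _ "g - f"])

lemma coset_eq_iff:
  assumes I: "ideal I (pol_ring n)"
  shows "I +>\<^bsub>pol_ring n\<^esub> f = I +>\<^bsub>pol_ring n\<^esub> g \<longleftrightarrow> f - g \<in> I"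
proof
  assume "I +>\<^bsub>pol_ring n\<^esub> f = I +>\<^bsub>pol_ring n\<^esub> g"
  moreover have "f \<in> I +>\<^bsub>pol_ring n\<^esub> f" by (simp add: mem_coset ideal_zero[OF I])
  ultimately show "f - g \<in> I" by (simp add: mem_coset)
next
  assume fg: "f - g \<in> I"
  have "h - f \<in> I \<longleftrightarrow> h - g \<in> I" for h
    using ideal_add[OF I _ fg, of "h - f"] ideal_diff[OF I _ fg, of "h - g"] by auto
  thus "I +>\<^bsub>pol_ring n\<^esub> f = I +>\<^bsub>pol_ring n\<^esub> g" by (simp add: set_eq_iff mem_coset)
qed

text \<open>
  An ideal with homogeneous generators is homogeneous: the elements all of whose components lie in it
  form an ideal containing the generators. Closure under multiplication reduces to multiplication by
  monomials, which shift degrees.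
\<close>

lemma hcomp_genideal:
  assumes S: "S \<subseteq> carrier (pol_ring n)" and hom: "\<And>f. f \<in> S \<Longrightarrow> \<exists>d. homogeneous d f"
    and f: "f \<in> Idl\<^bsub>pol_ring n\<^esub> S"
  shows "hcomp d f \<in> Idl\<^bsub>pol_ring n\<^esub> S"
proof -
  let ?I = "Idl\<^bsub>pol_ring n\<^esub> S"
  let ?J = "{f \<in> carrier (pol_ring n). \<forall>d. hcomp d f \<in> ?I}"
  have I: "ideal ?I (pol_ring n)" by (rule ring.genideal_ideal[OF pol_ring_ring S])
  have m: "hcomp d (a * f) \<in> ?I" if f: "\<And>d. hcomp d f \<in> ?I" and a: "a \<in> carrier (pol_ring n)" for a f d
    using a unfolding mem_pol
  proof (rule pm_induct)
    fix m :: "nat \<Rightarrow>\<^sub>0 nat" and c :: qfield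
    assume "m \<in> {m. Poly_Mapping.keys m \<subseteq> {1..n}}"
    hence "sgl m c \<in> carrier (pol_ring n)" by (simp add: mem_pol)
    thus "hcomp d (sgl m c * f) \<in> ?I"
      by (simp add: hcomp_mult[OF homogeneous_single] ideal_zero[OF I] ideal_mult[OF I _ f])
  qed (auto simp: distrib_right intro: ideal_zero[OF I] ideal_add[OF I])
  have "?I \<subseteq> ?J"
  proof (rule ring.genideal_minimal[OF pol_ring_ring])
    show "ideal ?J (pol_ring n)"
      by (rule pol_idealI) (auto simp: m pol_mult pol_add intro: ideal_zero[OF I] ideal_add[OF I])
    show "S \<subseteq> ?J"
    proof
      fix f assume "f \<in> S"
      moreover from this hom obtain e where "homogeneous e f" by blast
      ultimately show "f \<in> ?J"
        using S ring.genideal_self[OF pol_ring_ring S]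
        by (auto simp: hcomp_homogeneous intro: ideal_zero[OF I])
    qed
  qed
  thus ?thesis using f by blast
qed

section \<open>The twisted Leibniz rule and stable ideals\<close>

text \<open>
  Multiply by \<open>x\<^sub>i - x\<^sub>i\<^sub>+\<^sub>1\<close>: the part of \<open>(x\<^sub>i - x\<^sub>i\<^sub>+\<^sub>1) T\<^sub>i(f g)\<close> that involves \<open>s\<^sub>i.g\<close> already has the
  factor \<open>s\<^sub>i.f\<close>, and in the other part \<open>f\<close> is replaced by \<open>s\<^sub>i.f + (f - s\<^sub>i.f)\<close>.
\<close>

lemma hecke_op_leibniz:
  assumes i: "i \<in> {1..<n}" and f: "f \<in> carrier (pol_ring n)" and g: "g \<in> carrier (pol_ring n)"
  shows "hecke_op i (f * g) =
    swap_vars i f * hecke_op i g + (1 - const qpar) * var (Suc i) * ddiff i f * g"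
proof (rule hecke_op_eqI[OF i pol_mult[OF f g]])
  let ?D = "var i - var (Suc i)"
  have "?D * (swap_vars i f * hecke_op i g + (1 - const qpar) * var (Suc i) * ddiff i f * g)
    = swap_vars i f * (?D * hecke_op i g) + (1 - const qpar) * var (Suc i) * (?D * ddiff i f) * g"
    by (simp add: algebra_simps)
  thus "?D * (swap_vars i f * hecke_op i g + (1 - const qpar) * var (Suc i) * ddiff i f * g)
    = (const qpar * var i - var (Suc i)) * swap_vars i (f * g) + (1 - const qpar) * var (Suc i) * (f * g)"
    unfolding hecke_op_mult[OF i g] ddiff_mult[OF i f] by (simp add: algebra_simps)
qed

lemma hecke_op_symmetric:
  assumes "i \<in> {1..<n}" "f \<in> carrier (pol_ring n)" "swap_vars i f = f"
  shows "hecke_op i f = const qpar * f"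
  by (rule hecke_op_eqI[OF assms(1,2)]) (simp add: assms(3) algebra_simps)

text \<open>
  By the Leibniz rule, the elements of the ideal that \<open>T\<^sub>i\<close> maps into the ideal are themselves an
  ideal, so it suffices to look at generators.
\<close>

lemma hecke_op_genideal:
  assumes i: "i \<in> {1..<n}" and S: "S \<subseteq> carrier (pol_ring n)"
    and gen: "\<And>g. g \<in> S \<Longrightarrow> hecke_op i g \<in> Idl\<^bsub>pol_ring n\<^esub> S"
    and f: "f \<in> Idl\<^bsub>pol_ring n\<^esub> S"
  shows "hecke_op i f \<in> Idl\<^bsub>pol_ring n\<^esub> S"
proof -
  let ?I = "Idl\<^bsub>pol_ring n\<^esub> S"
  let ?J = "{f \<in> ?I. hecke_op i f \<in> ?I}"
  have I: "ideal ?I (pol_ring n)" by (rule ring.genideal_ideal[OF pol_ring_ring S])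
  note c = ideal_closed[OF I]
  have y: "(1 - const qpar) * var (Suc i) \<in> carrier (pol_ring n)"
    using i by (intro pol_mult pol_diff pol_var) auto
  have "?I \<subseteq> ?J"
  proof (rule ring.genideal_minimal[OF pol_ring_ring])
    show "ideal ?J (pol_ring n)"
    proof (rule pol_idealI)
      fix f g assume "f \<in> ?J" "g \<in> ?J"
      thus "f + g \<in> ?J" by (auto simp: hecke_op_add[OF i] c intro: ideal_add[OF I])
    next
      fix a f assume "a \<in> carrier (pol_ring n)" "f \<in> ?J"
      thus "a * f \<in> ?J"
        by (auto simp: hecke_op_leibniz[OF i] c
            intro!: ideal_add[OF I] ideal_mult[OF I] pol_mult y swap_closed[OF i] ddiff_closed[OF i])
    next
      have "hecke_op i 0 = 0" using hecke_op_const[OF i pol_0, of 0] by simp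
      thus "0 \<in> ?J" by (simp add: ideal_zero[OF I])
    qed (use c in auto)
    show "S \<subseteq> ?J" using gen ring.genideal_self[OF pol_ring_ring S] by auto
  qed
  thus ?thesis using f by blast
qed

section \<open>Homogeneity and symmetry of the generators\<close>

lemma swap_one [simp]: "swap_vars i 1 = 1"
  using swap_const[of i 1] by simp

lemma swap_sum: "swap_vars i (sum f A) = (\<Sum>a\<in>A. swap_vars i (f a))"
  by (induction A rule: infinite_finite_induct) auto
lemma swap_prod: "swap_vars i (prod f A) = (\<Prod>a\<in>A. swap_vars i (f a))"
  by (induction A rule: infinite_finite_induct) auto
lemma swap_power: "swap_vars i (f ^ m) = swap_vars i f ^ m"
  by (induction m) auto

lemma bij_betw_tr: "i \<noteq> m \<Longrightarrow> 1 \<le> i \<Longrightarrow> bij_betw (tr i) {1..m} {1..m}"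
  by (rule bij_betw_byWitness[where f' = "tr i"]) (auto simp: transpose_def)

lemma elem_sym_swap:
  assumes "i \<in> {1..<n}"
  shows "swap_vars i (elem_sym d n) = elem_sym d n"
proof -
  have t: "tr i j \<in> {1..n}" if "j \<in> {1..n}" for j
    using that assms by (auto simp: transpose_def)
  have b: "bij_betw ((`) (tr i)) {A. A \<subseteq> {1..n} \<and> card A = d} {A. A \<subseteq> {1..n} \<and> card A = d}"
    by (rule bij_betw_byWitness[where f' = "(`) (tr i)"])
      (use t in \<open>auto simp: image_image card_image inj_on_subset[OF inj_tr] simp del: atLeastAtMost_iff\<close>)
  have "(\<Prod>j\<in>A. swap_vars i (var j)) = (\<Prod>j\<in>tr i ` A. var j)" for A
    by (subst prod.reindex) (auto intro: inj_on_subset[OF inj_tr])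
  thus ?thesis unfolding elem_sym_def swap_sum swap_prod
    using sum.reindex_bij_betw[OF b, of "\<lambda>A. \<Prod>j\<in>A. var j"] by simp
qed

text \<open>
  Power series whose coefficient at \<open>t\<^sup>d\<close> has degree \<open>d\<close> are closed under products, so one
  argument yields that the Hall-Littlewood polynomials are homogeneous and that they lie in the
  polynomial ring in finitely many variables.
\<close>
definition graded_series :: "nat \<Rightarrow> mpol fps set" where
  "graded_series n = {F. \<forall>d. fps_nth F d \<in> carrier (pol_ring n) \<and> homogeneous d (fps_nth F d)}"

lemma graded_series_mult:
  assumes "F \<in> graded_series n" "G \<in> graded_series n"
  shows "F * G \<in> graded_series n"
proof -
  have "homogeneous d (fps_nth F j * fps_nth G (d - j))" if "j \<le> d" for d j
    using homogeneous_mult[of j "fps_nth F j" "d - j" "fps_nth G (d - j)"] assms that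
    by (auto simp: graded_series_def)
  with assms show ?thesis
    by (auto simp: graded_series_def fps_mult_nth intro!: pol_sum pol_mult homogeneous_sum)
qed

definition hl_factor :: "nat \<Rightarrow> mpol fps" where
  "hl_factor j = (1 - fps_const (const qpar * var j) * fps_X) * Abs_fps (\<lambda>m. var j ^ m)"

lemma hl_series_factor: "hall_littlewood_series i = (\<Prod>j = 1..i. hl_factor j)"
  by (simp add: hall_littlewood_series_def hl_factor_def)

lemma pow_closed:
  "j \<in> {1..n} \<Longrightarrow> var j ^ d \<in> carrier (pol_ring n) \<and> homogeneous d (var j ^ d)"
proof (induction d)
  case (Suc d)
  thus ?case using homogeneous_mult[OF homogeneous_var, of d "var j ^ d" j]
    by (auto intro!: pol_mult pol_var)
qed auto

lemma hl_factor_graded: "j \<in> {1..n} \<Longrightarrow> hl_factor j \<in> graded_series n"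
  unfolding hl_factor_def
proof (rule graded_series_mult)
  assume j: "j \<in> {1..n}"
  show "1 - fps_const (const qpar * var j) * fps_X \<in> graded_series n"
    unfolding graded_series_def
  proof (intro CollectI allI)
    fix d
    have *: "const qpar * var j \<in> carrier (pol_ring n)" "homogeneous (Suc 0) (const qpar * var j)"
      using j homogeneous_const_mult[OF homogeneous_var] by (auto intro!: pol_mult pol_var)
    consider "d = 0" | "d = 1" | e where "d = Suc (Suc e)" by (metis One_nat_def not0_implies_Suc)
    thus "fps_nth (1 - fps_const (const qpar * var j) * fps_X) d \<in> carrier (pol_ring n) \<and>
        homogeneous d (fps_nth (1 - fps_const (const qpar * var j) * fps_X) d)"
      using * by cases (auto simp: homogeneous_wdeg mem_pol)
  qed
  show "Abs_fps (\<lambda>m. var j ^ m) \<in> graded_series n"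
    using pow_closed[OF j] by (auto simp: graded_series_def)
qed

lemma hl_series_graded: "i \<le> n \<Longrightarrow> hall_littlewood_series i \<in> graded_series n"
proof (induction i)
  case 0
  have "(1 :: mpol fps) \<in> graded_series n" by (auto simp: graded_series_def)
  thus ?case by (simp add: hl_series_factor)
next
  case (Suc i)
  thus ?case by (simp add: hl_series_factor graded_series_mult hl_factor_graded)
qed

lemma hall_littlewood_closed: "i \<le> n \<Longrightarrow> hall_littlewood d i \<in> carrier (pol_ring n)"
  and homogeneous_hall_littlewood: "homogeneous d (hall_littlewood d i)"
  using hl_series_graded[of i n] hl_series_graded[of i i] unfolding hall_littlewood_def
  by (auto simp: graded_series_def intro!: pol_mult homogeneous_const_mult)

lemma elem_sym_closed: "elem_sym d n \<in> carrier (pol_ring n)"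
  and homogeneous_elem_sym: "homogeneous d (elem_sym d n)"
proof -
  have "finite A \<Longrightarrow> A \<subseteq> {1..n} \<Longrightarrow> (\<Prod>j\<in>A. var j) \<in> carrier (pol_ring n) \<and> homogeneous (card A) (\<Prod>j\<in>A. var j)" for A
  proof (induction A rule: finite_induct)
    case (insert j A)
    thus ?case using homogeneous_mult[OF homogeneous_var, of "card A" "\<Prod>j\<in>A. var j" j]
      by (auto intro!: pol_mult pol_var)
  qed auto
  hence "(\<Prod>j\<in>A. var j) \<in> carrier (pol_ring n) \<and> homogeneous (card A) (\<Prod>j\<in>A. var j)" if "A \<subseteq> {1..n}" for A
    using that finite_subset by blast
  thus "elem_sym d n \<in> carrier (pol_ring n)" "homogeneous d (elem_sym d n)"
    unfolding elem_sym_def by (auto intro!: pol_sum homogeneous_sum)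
qed

text \<open>
  Acting on coefficients, \<open>s\<^sub>i\<close> is an automorphism of the ring of power series which permutes the
  factors of the Hall-Littlewood generating functions.
\<close>
definition swap_series :: "nat \<Rightarrow> mpol fps \<Rightarrow> mpol fps" where
  "swap_series i F = Abs_fps (\<lambda>d. swap_vars i (fps_nth F d))"

lemma swap_series_1 [simp]: "swap_series i 1 = 1"
  by (auto simp: swap_series_def fps_eq_iff)
lemma swap_series_mult [simp]: "swap_series i (F * G) = swap_series i F * swap_series i G"
  by (simp add: swap_series_def fps_eq_iff fps_mult_nth swap_sum)
lemma swap_series_prod: "swap_series i (prod F A) = (\<Prod>a\<in>A. swap_series i (F a))"
  by (induction A rule: infinite_finite_induct) auto

lemma swap_series_factor: "swap_series i (hl_factor j) = hl_factor (tr i j)"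
proof -
  have "swap_series i (1 - fps_const (const qpar * var j) * fps_X) = 1 - fps_const (const qpar * var (tr i j)) * fps_X"
    by (rule fps_ext) (simp add: swap_series_def fps_X_def)
  moreover have "swap_series i (Abs_fps (\<lambda>m. var j ^ m)) = Abs_fps (\<lambda>m. var (tr i j) ^ m)"
    by (simp add: swap_series_def fps_eq_iff swap_power)
  ultimately show ?thesis by (simp add: hl_factor_def)
qed

lemma hall_littlewood_swap:
  assumes "1 \<le> i" "i \<noteq> m"
  shows "swap_vars i (hall_littlewood d m) = hall_littlewood d m"
proof -
  have "swap_series i (hall_littlewood_series m) = (\<Prod>j = 1..m. hl_factor (tr i j))"
    by (simp add: hl_series_factor swap_series_prod swap_series_factor)
  also have "\<dots> = hall_littlewood_series m"
    unfolding hl_series_factor by (rule prod.reindex_bij_betw[OF bij_betw_tr[OF assms(2,1)]])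
  finally show ?thesis
    by (simp add: hall_littlewood_def swap_series_def fps_eq_iff)
qed

section \<open>The three-term relation and stability of the ideal\<close>

text \<open>
  Here \<open>u\<close> and \<open>v\<close> are the geometric series for \<open>1 / (1 - x t)\<close> and \<open>1 / (1 - y t)\<close>, and \<open>A\<close> is the
  generating function in the variables before \<open>x\<close>. Bringing every term over the common denominator
  \<open>(1 - x t) (1 - y t)\<close> leaves the polynomial identity \<open>key\<close>. The coefficients \<open>1, -1, q\<close>
  come from solving the linear system for
  \<open>\<beta> (1 - q x t) (1 - q y t) + \<gamma> (1 - q x t) (1 - y t) + \<alpha> (1 - x t) (1 - y t)\<close> to be the numerator
  of \<open>T\<^sub>i\<close> applied to the generating function that ends with \<open>x\<close>.
\<close>
lemma three_term_identity:
  fixes x y q t u v A :: "'a::comm_ring_1"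
  assumes u: "(1 - x * t) * u = 1" and v: "(1 - y * t) * v = 1"
  shows "(x - y) * (A * ((1 - q * x * t) * u) * ((1 - q * y * t) * v) - A * ((1 - q * x * t) * u) + q * A)
    = (q * x - y) * (A * ((1 - q * y * t) * v)) + (1 - q) * y * (A * ((1 - q * x * t) * u))"
proof -
  let ?X = "1 - x * t" and ?Y = "1 - y * t" and ?P = "1 - q * x * t" and ?Q = "1 - q * y * t"
  have 1: "A * (?P * u) = A * u * v * (?P * ?Y)"
  proof -
    have "A * u * v * (?P * ?Y) = A * (?P * u) * (?Y * v)" by (simp only: ac_simps)
    thus ?thesis by (simp only: v mult_1_right)
  qed
  have 2: "A * (?Q * v) = A * u * v * (?Q * ?X)"
  proof -
    have "A * u * v * (?Q * ?X) = A * (?Q * v) * (?X * u)" by (simp only: ac_simps)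
    thus ?thesis by (simp only: u mult_1_right)
  qed
  have 3: "A = A * u * v * (?X * ?Y)"
  proof -
    have "A * u * v * (?X * ?Y) = A * (?X * u) * (?Y * v)" by (simp only: ac_simps)
    thus ?thesis by (simp only: u v mult_1_right)
  qed
  have 4: "A * (?P * u) * (?Q * v) = A * u * v * (?P * ?Q)" by (simp only: ac_simps)
  have "(x - y) * (B * (?P * ?Q) - B * (?P * ?Y) + q * (B * (?X * ?Y)))
    = (q * x - y) * (B * (?Q * ?X)) + (1 - q) * y * (B * (?P * ?Y))" for B
    by (simp add: algebra_simps)
  note key = this[of "A * u * v", folded 3]
  show ?thesis unfolding 4 unfolding 1 2 by (rule key)
qed

lemma hecke_op_hall_littlewood:
  assumes i: "i \<in> {1..<n}"
  shows "hecke_op i (hall_littlewood d i)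
    = hall_littlewood d (i + 1) - hall_littlewood d i + const qpar * hall_littlewood d (i - 1)"
proof (rule hecke_op_eqI[OF i])
  obtain j where j: "i = Suc j" using i by (cases i) auto
  let ?A = "hall_littlewood_series j"
  let ?x = "var i" let ?y = "var (Suc i)"
  have S1: "hall_littlewood_series i = ?A * hl_factor i"
    and S2: "hall_littlewood_series (Suc i) = ?A * hl_factor i * hl_factor (Suc i)"
    by (simp_all add: hl_series_factor j)
  have A: "swap_series i ?A = ?A"
    unfolding hl_series_factor swap_series_prod swap_series_factor
    by (intro prod.cong) (auto simp: j transpose_def)
  have S3: "swap_series i (hall_littlewood_series i) = ?A * hl_factor (Suc i)"
    by (simp add: S1 A swap_series_factor)
  have G: "(fps_const ?x - fps_const ?y) * (hall_littlewood_series (Suc i) - hall_littlewood_series i + fps_const (const qpar) * ?A)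
    = (fps_const (const qpar) * fps_const ?x - fps_const ?y) * swap_series i (hall_littlewood_series i)
      + (1 - fps_const (const qpar)) * fps_const ?y * hall_littlewood_series i"
    unfolding S3 unfolding S1 S2 hl_factor_def fps_const_mult[symmetric]
    by (rule three_term_identity[OF hl_geom hl_geom])
  have N: "(?x - ?y) * (fps_nth (hall_littlewood_series (Suc i)) d - fps_nth (hall_littlewood_series i) d + const qpar * fps_nth ?A d)
    = (const qpar * ?x - ?y) * swap_vars i (fps_nth (hall_littlewood_series i) d)
      + (1 - const qpar) * ?y * fps_nth (hall_littlewood_series i) d"
    using arg_cong[OF G, of "\<lambda>F. fps_nth F d"]
    by (simp add: fps_mult_left_const_nth swap_series_def flip: fps_const_1_eq_1)
  let ?c = "const (inverse (1 - qpar))"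
  \<comment> \<open>The generating function has the coefficients \<open>(1 - q) P\<^sub>d\<close>, so this factor is divided out.\<close>
  from arg_cong[OF N, of "(*) ?c"]
  show "(?x - ?y) * (hall_littlewood d (i + 1) - hall_littlewood d i + const qpar * hall_littlewood d (i - 1))
    = (const qpar * ?x - ?y) * swap_vars i (hall_littlewood d i) + (1 - const qpar) * ?y * hall_littlewood d i"
    by (simp add: hall_littlewood_def j algebra_simps)
qed (use i in \<open>auto intro: hall_littlewood_closed\<close>)

lemma hall_littlewood_0: "1 \<le> d \<Longrightarrow> hall_littlewood d 0 = 0"
  by (simp add: hall_littlewood_def hall_littlewood_series_def)

abbreviation (input) "hl_gens n k \<equiv>
  {hall_littlewood k i | i. i \<in> {1..n}} \<union> {elem_sym d n | d. d \<in> {n - k + 1..n}}"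

lemma hl_gens_closed: "hl_gens n k \<subseteq> carrier (pol_ring n)"
  by (auto intro: hall_littlewood_closed elem_sym_closed)

lemma hl_ideal: "ideal (hl_ideal n k) (pol_ring n)"
  unfolding hl_ideal_def by (rule ring.genideal_ideal[OF pol_ring_ring hl_gens_closed])

lemma hl_gens_hl_ideal: "hl_gens n k \<subseteq> hl_ideal n k"
  unfolding hl_ideal_def by (rule ring.genideal_self[OF pol_ring_ring hl_gens_closed])

lemma hcomp_hl_ideal: "f \<in> hl_ideal n k \<Longrightarrow> hcomp d f \<in> hl_ideal n k"
  unfolding hl_ideal_def
  by (rule hcomp_genideal[OF hl_gens_closed])
    (use homogeneous_hall_littlewood homogeneous_elem_sym in blast)

text \<open>
  Only the generator \<open>P\<^sub>k(x\<^sub>1,\<dots>,x\<^sub>i)\<close> is not fixed by \<open>s\<^sub>i\<close>. Its image involves \<open>P\<^sub>k\<close> in \<open>i + 1 \<le> n\<close> and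
  in \<open>i - 1\<close> variables; for \<open>i = 1\<close> the latter is not a generator, but it is zero.
\<close>

lemma hecke_op_hl_ideal:
  assumes k: "1 \<le> k" and i: "i \<in> {1..<n}" and f: "f \<in> hl_ideal n k"
  shows "hecke_op i f \<in> hl_ideal n k"
proof -
  note I = hl_ideal[of n k]
  have P: "hall_littlewood k j \<in> hl_ideal n k" if "j \<le> n" for j
  proof (cases "j = 0")
    case True
    thus ?thesis using hall_littlewood_0[OF k] ideal_zero[OF I] by simp
  next
    case False
    with that have "hall_littlewood k j \<in> hl_gens n k" by force
    thus ?thesis using hl_gens_hl_ideal by blast
  qed
  have sym: "hecke_op i g \<in> hl_ideal n k" if "g \<in> hl_ideal n k" "swap_vars i g = g" for g
    using that ideal_mult[OF I] by (simp add: hecke_op_symmetric[OF i] ideal_closed[OF I])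
  have gen: "hecke_op i g \<in> hl_ideal n k" if "g \<in> hl_gens n k" for g
  proof -
    from that consider j where "j \<in> {1..n}" "g = hall_littlewood k j" | d where "g = elem_sym d n"
      by blast
    thus ?thesis
    proof cases
      case (1 j)
      show ?thesis
      proof (cases "j = i")
        case True
        thus ?thesis using i
          by (auto simp: 1(2) hecke_op_hall_littlewood[OF i]
              intro!: ideal_add[OF I] ideal_diff[OF I] ideal_mult[OF I] P)
      next
        case False
        thus ?thesis using i 1 by (intro sym) (auto intro: P hall_littlewood_swap)
      qed
    next
      case (2 d)
      have "g \<in> hl_ideal n k" using that hl_gens_hl_ideal by blast
      thus ?thesis by (rule sym) (simp add: 2 elem_sym_swap[OF i])
    qed
  qed
  show ?thesis
    using hecke_op_genideal[OF i hl_gens_closed gen[unfolded hl_ideal_def] f[unfolded hl_ideal_def]]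
    by (simp add: hl_ideal_def)
qed

lemma free_act_hl_ideal:
  assumes k: "1 \<le> k" and a: "a \<in> carrier (free_alg_ring n)" and f: "f \<in> hl_ideal n k"
  shows "free_act a f \<in> hl_ideal n k"
proof -
  note I = hl_ideal[of n k]
  have w: "foldr hecke_op u f \<in> hl_ideal n k" if "set u \<subseteq> {1..<n}" for u
    using that by (induction u) (auto simp: f intro!: hecke_op_hl_ideal[OF k] simp del: atLeastLessThan_iff)
  show ?thesis using a unfolding mem_free
    by (rule pm_induct)
      (auto simp: free_act_single intro!: ideal_zero[OF I] ideal_add[OF I] ideal_mult[OF I] w)
qed

lemma hecke_algebra_cases:
  assumes "h \<in> carrier (hecke_algebra n)"
  obtains a where "a \<in> carrier (free_alg_ring n)"
    "\<And>f. f \<in> carrier (pol_ring n) \<Longrightarrow> hecke_act h f = free_act a f"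
  using assms hecke_act_coset unfolding hecke_algebra_carrier by blast

lemma hecke_act_hl_ideal:
  assumes "1 \<le> k" "h \<in> carrier (hecke_algebra n)" "f \<in> hl_ideal n k"
  shows "hecke_act h f \<in> hl_ideal n k"
  using assms free_act_hl_ideal ideal_closed[OF hl_ideal] by (metis hecke_algebra_cases)

lemma homogeneous_hecke_act:
  assumes h: "h \<in> carrier (hecke_algebra n)" and f: "f \<in> carrier (pol_ring n)"
    and d: "homogeneous d f"
  shows "homogeneous d (hecke_act h f)"
proof -
  obtain a where a: "a \<in> carrier (free_alg_ring n)" "hecke_act h f = free_act a f"
    using h f by (metis hecke_algebra_cases)
  have "hcomp d (free_act a f) = free_act a f"
    by (simp add: hcomp_free_act[OF a(1) f] hcomp_homogeneous[OF d])
  thus ?thesis using homogeneous_hcomp[of d "free_act a f"] a by simp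
qed

section \<open>The graded quotient module\<close>

abbreviation (input) "hl_coset n k f \<equiv> hl_ideal n k +>\<^bsub>pol_ring n\<^esub> f"

lemma hl_quotient_carrier:
  "carrier (hl_quotient n k) = {hl_coset n k f | f. f \<in> carrier (pol_ring n)}"
  by (auto simp: hl_quotient_def FactRing_def A_RCOSETS_def')

lemma hl_coset_0: "hl_coset n k 0 = hl_ideal n k"
  by (auto simp: mem_coset)

lemma hl_quotient_zero: "\<zero>\<^bsub>hl_quotient n k\<^esub> = hl_coset n k 0"
  by (simp add: hl_coset_0) (simp add: hl_quotient_def FactRing_def)

lemma hl_coset_eq_zero: "hl_coset n k f = \<zero>\<^bsub>hl_quotient n k\<^esub> \<longleftrightarrow> f \<in> hl_ideal n k"
  by (simp add: hl_quotient_zero coset_eq_iff[OF hl_ideal])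

lemma hl_quotient_add:
  "f \<in> carrier (pol_ring n) \<Longrightarrow> g \<in> carrier (pol_ring n) \<Longrightarrow>
    hl_coset n k f \<oplus>\<^bsub>hl_quotient n k\<^esub> hl_coset n k g = hl_coset n k (f + g)"
  using abelian_subgroup.a_rcos_sum[OF abelian_subgroupI3[OF ideal.axioms(1)[OF hl_ideal]
      ring.is_abelian_group[OF pol_ring_ring]], of f n g k]
  by (simp add: hl_quotient_def FactRing_def)

lemma hl_quotient_group: "abelian_group (hl_quotient n k)"
  unfolding hl_quotient_def by (rule ring.is_abelian_group[OF ideal.quotient_is_ring[OF hl_ideal]])

lemma hl_quotient_finsum:
  assumes "finite D" "\<And>d. d \<in> D \<Longrightarrow> g d \<in> carrier (pol_ring n)"
  shows "finsum (hl_quotient n k) (\<lambda>d. hl_coset n k (g d)) D = hl_coset n k (\<Sum>d\<in>D. g d)"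
  using assms
proof (induction D rule: finite_induct)
  case empty
  show ?case by (simp add: abelian_monoid.finsum_empty[OF abelian_group.axioms(1)[OF hl_quotient_group]] hl_quotient_zero)
next
  case (insert d D)
  thus ?case
    by (subst abelian_monoid.finsum_insert[OF abelian_group.axioms(1)[OF hl_quotient_group]])
      (auto simp: hl_quotient_carrier hl_quotient_add pol_sum)
qed

text \<open>
  Representatives of a coset differ by an element \<open>r\<close> of the ideal, and \<open>h.r\<close> lies in the ideal
  again. So all cosets in the union that defines the action coincide.
\<close>

lemma hl_quotient_act_coset:
  assumes k: "1 \<le> k" and h: "h \<in> carrier (hecke_algebra n)" and f: "f \<in> carrier (pol_ring n)"
  shows "hl_quotient_act n k h (hl_coset n k f) = hl_coset n k (hecke_act h f)"
proof -
  have "hl_coset n k (hecke_act h g) = hl_coset n k (hecke_act h f)" if "g \<in> hl_coset n k f" for g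
  proof -
    have g: "g - f \<in> hl_ideal n k" using that by (simp add: mem_coset)
    have "hecke_act h g = hecke_act h f + hecke_act h (g - f)"
      using left_module.act_r_distr[OF left_module_pol_ring h f ideal_closed[OF hl_ideal g]] by simp
    thus ?thesis
      using hecke_act_hl_ideal[OF k h g] by (simp add: coset_eq_iff[OF hl_ideal])
  qed
  moreover have "f \<in> hl_coset n k f" by (simp add: mem_coset ideal_zero[OF hl_ideal])
  ultimately show ?thesis unfolding hl_quotient_act_def by blast
qed

lemma left_module_hl_quotient:
  assumes k: "1 \<le> k"
  shows "left_module (hecke_algebra n) (hl_quotient n k) (hl_quotient_act n k)"
proof -
  interpret P: left_module "hecke_algebra n" "pol_ring n" hecke_act
    by (rule left_module_pol_ring)
  note [simp] = hl_quotient_act_coset[OF k] hl_quotient_add P.act_closed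
    P.act_closed[simplified] pol_add P.act_assoc P.act_one
    P.act_l_distr[simplified] P.act_r_distr[simplified]
  show ?thesis
    by (intro left_module.intro left_module_axioms.intro P.R.ring_axioms hl_quotient_group)
      (auto simp: hl_quotient_carrier)
qed

text \<open>
  Existence: take the cosets of the homogeneous components of a representative \<open>f\<close>. Uniqueness: two
  decompositions differ by an element of the ideal, and the ideal is homogeneous, so they already
  agree modulo the ideal in every degree.
\<close>

lemma hl_quotient_direct_sum:
  assumes "X \<in> carrier (hl_quotient n k)"
  shows "\<exists>!c. (\<forall>d. c d \<in> hl_quotient_piece n k d) \<and> finite {d. c d \<noteq> \<zero>\<^bsub>hl_quotient n k\<^esub>} \<and>
    X = finsum (hl_quotient n k) c {d. c d \<noteq> \<zero>\<^bsub>hl_quotient n k\<^esub>}"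
proof -
  note I = hl_ideal[of n k]
  obtain f where f: "f \<in> carrier (pol_ring n)" and X: "X = hl_coset n k f"
    using assms by (auto simp: hl_quotient_carrier)
  let ?c = "\<lambda>d. hl_coset n k (hcomp d f)"
  let ?S = "{d. ?c d \<noteq> \<zero>\<^bsub>hl_quotient n k\<^esub>}"
  show ?thesis
  proof (rule ex1I[of _ ?c], intro conjI allI)
    show "?c d \<in> hl_quotient_piece n k d" for d
      using hcomp_closed[OF f] by (auto simp: hl_quotient_piece_def)
    have sub: "?S \<subseteq> {d. hcomp d f \<noteq> 0}"
      by (auto simp: hl_coset_eq_zero ideal_zero[OF I])
    show fin: "finite ?S" by (rule finite_subset[OF sub finite_hcomp])
    have "f = (\<Sum>d\<in>{d. hcomp d f \<noteq> 0}. hcomp d f)"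
      by (rule sum_hcomp[symmetric]) (auto simp: finite_hcomp)
    \<comment> \<open>A nonzero component may lie in the ideal, so the support of the cosets can be smaller than
      that of the components.\<close>
    also have "\<dots> = (\<Sum>d\<in>{d. hcomp d f \<noteq> 0} - ?S. hcomp d f) + (\<Sum>d\<in>?S. hcomp d f)"
      by (rule sum.subset_diff[OF sub finite_hcomp])
    finally have "f - (\<Sum>d\<in>?S. hcomp d f) = (\<Sum>d\<in>{d. hcomp d f \<noteq> 0} - ?S. hcomp d f)"
      by (simp only: diff_eq_eq)
    also have "\<dots> \<in> hl_ideal n k"
      by (rule ideal_sum[OF I]) (auto simp: hl_coset_eq_zero)
    finally show "X = finsum (hl_quotient n k) ?c ?S"
      unfolding X by (subst hl_quotient_finsum[OF fin hcomp_closed[OF f]]) (simp add: coset_eq_iff[OF I])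
  next
    fix c
    assume c: "(\<forall>d. c d \<in> hl_quotient_piece n k d) \<and> finite {d. c d \<noteq> \<zero>\<^bsub>hl_quotient n k\<^esub>} \<and>
      X = finsum (hl_quotient n k) c {d. c d \<noteq> \<zero>\<^bsub>hl_quotient n k\<^esub>}"
    let ?D = "{d. c d \<noteq> \<zero>\<^bsub>hl_quotient n k\<^esub>}"
    have "\<exists>g. g \<in> carrier (pol_ring n) \<and> homogeneous d g \<and> c d = hl_coset n k g" for d
      using c by (auto simp: hl_quotient_piece_def)
    then obtain g where g: "\<And>d. g d \<in> carrier (pol_ring n)" "\<And>d. homogeneous d (g d)"
      and cg: "c = (\<lambda>d. hl_coset n k (g d))" by metis
    have "hl_coset n k f = hl_coset n k (\<Sum>d\<in>?D. g d)"
      using c X hl_quotient_finsum[of ?D g n k] g(1) by (simp add: cg)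
    hence fg: "f - (\<Sum>d\<in>?D. g d) \<in> hl_ideal n k"
      by (simp only: coset_eq_iff[OF I])
    show "c = ?c"
    proof
      fix e
      have "hcomp e (\<Sum>d\<in>?D. g d) = (if e \<in> ?D then g e else 0)"
        using c by (simp add: hcomp_sum hcomp_homogeneous[OF g(2)] sum.delta)
      hence m: "hcomp e f - (if e \<in> ?D then g e else 0) \<in> hl_ideal n k"
        using hcomp_hl_ideal[OF fg, of e] by simp
      show "c e = ?c e"
      proof (cases "e \<in> ?D")
        case True
        with m have "?c e = hl_coset n k (g e)" by (simp add: coset_eq_iff[OF I])
        thus ?thesis by (simp add: cg)
      next
        case False
        with m have "?c e = \<zero>\<^bsub>hl_quotient n k\<^esub>" by (simp add: hl_coset_eq_zero)
        with False show ?thesis by simp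
      qed
    qed
  qed
qed

lemma hl_quotient_piece_subgroup:
  "subgroup (hl_quotient_piece n k d) (add_monoid (hl_quotient n k))"
proof (rule group.subgroupI[OF abelian_group.a_group[OF hl_quotient_group]])
  note G = abelian_group.a_group[OF hl_quotient_group[of n k]]
  show "hl_quotient_piece n k d \<subseteq> carrier (add_monoid (hl_quotient n k))"
    by (auto simp: hl_quotient_piece_def hl_quotient_carrier)
  have "hl_coset n k 0 \<in> hl_quotient_piece n k d"
    unfolding hl_quotient_piece_def using homogeneous_0 pol_0 by blast
  thus "hl_quotient_piece n k d \<noteq> {}" by blast
  fix X assume "X \<in> hl_quotient_piece n k d"
  then obtain f where f: "f \<in> carrier (pol_ring n)" "homogeneous d f" and X: "X = hl_coset n k f"
    by (auto simp: hl_quotient_piece_def)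
  have f': "- f \<in> carrier (pol_ring n)" "homogeneous d (- f)"
    using pol_uminus[OF f(1)] homogeneous_diff[OF homogeneous_0 f(2)] by auto
  have "inv\<^bsub>add_monoid (hl_quotient n k)\<^esub> X = hl_coset n k (- f)"
    using f f' by (intro group.inv_equality[OF G]) (auto simp: X hl_quotient_add hl_quotient_zero hl_quotient_carrier)
  thus "inv\<^bsub>add_monoid (hl_quotient n k)\<^esub> X \<in> hl_quotient_piece n k d"
    using f' by (auto simp: hl_quotient_piece_def)
  fix Y assume "Y \<in> hl_quotient_piece n k d"
  then obtain g where g: "g \<in> carrier (pol_ring n)" "homogeneous d g" and Y: "Y = hl_coset n k g"
    by (auto simp: hl_quotient_piece_def)
  have "X \<otimes>\<^bsub>add_monoid (hl_quotient n k)\<^esub> Y = hl_coset n k (f + g)"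
    using f g by (simp add: X Y hl_quotient_add)
  thus "X \<otimes>\<^bsub>add_monoid (hl_quotient n k)\<^esub> Y \<in> hl_quotient_piece n k d"
    using pol_add[OF f(1) g(1)] homogeneous_add[OF f(2) g(2)] by (auto simp: hl_quotient_piece_def)
qed

lemma graded_left_module_hl_quotient:
  assumes k: "1 \<le> k"
  shows "graded_left_module (hecke_algebra n) (hl_quotient n k) (hl_quotient_act n k) (hl_quotient_piece n k)"
proof (intro graded_left_module.intro graded_left_module_axioms.intro left_module_hl_quotient[OF k]
    hl_quotient_piece_subgroup hl_quotient_direct_sum)
  fix h X d assume h: "h \<in> carrier (hecke_algebra n)" and "X \<in> hl_quotient_piece n k d"
  then obtain f where f: "f \<in> carrier (pol_ring n)" "homogeneous d f" and X: "X = hl_coset n k f"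
    by (auto simp: hl_quotient_piece_def)
  show "hl_quotient_act n k h X \<in> hl_quotient_piece n k d"
    unfolding X hl_quotient_act_coset[OF k h f(1)] hl_quotient_piece_def
    using left_module.act_closed[OF left_module_pol_ring h f(1)] homogeneous_hecke_act[OF h f] by blast
qed

theorem proposition2p2:
  fixes n k :: nat
  assumes "1 \<le> k" and "k \<le> n"
  shows "(\<forall>h \<in> carrier (hecke_algebra n). \<forall>f \<in> hl_ideal n k. hecke_act h f \<in> hl_ideal n k)
    \<and> (\<forall>h \<in> carrier (hecke_algebra n). \<forall>f \<in> carrier (pol_ring n).
         hl_quotient_act n k h (hl_ideal n k +>\<^bsub>pol_ring n\<^esub> f)
           = hl_ideal n k +>\<^bsub>pol_ring n\<^esub> hecke_act h f)
    \<and> graded_left_module (hecke_algebra n) (hl_quotient n k)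
         (hl_quotient_act n k) (hl_quotient_piece n k)"
  using assms(1) by (simp add: hecke_act_hl_ideal hl_quotient_act_coset graded_left_module_hl_quotient)

end
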